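(* Let $\mathcal{X}$ be a finite set with $\operatorname{card}(\mathcal{X})=c<\infty$. Let $n\ge 1$ and $\lambda=(\lambda_1,\ldots,\lambda_n)\in\Lambda^n$, and let $P_n$ be the distribution of a $\lambda$-exchangeable sequence $(X_1,\ldots,X_n)$ on $\mathcal{X}$. Let $1\le k\le n$ and let $P_k$ be the marginal distribution of $(X_1,\ldots,X_k)$. Assume that $$r_i:=\frac{\min_{x\in\mathcal{X}}\lambda_i(x)}{\max_{x\in\mathcal{X}}\lambda_i(x)}>0\quad\text{for all } i\in\{1,\ldots,n\}.$$ Then there exists a mixture of weighted i.i.d. distributions $Q_n$ on $\mathcal{X}^n$ (with respect to the weights $\lambda$), with $Q_{n,k}$ denoting its marginal distribution on the first $k$ coordinates, such that $$|P_k-Q_{n,k}|_{TV}\le \frac{ck}{n}\cdot\frac{3-\prod_{i=1}^k r_i}{2\prod_{i=1}^k r_i}+\frac{\left(\prod_{i=k+1}^n r_i\right)^{-1/2}-1}{\left(\prod_{i=k+1}^n r_i\right)^{-1/2}+1}.$$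
   Context: $\mathcal{X}$ carries the discrete topology and $\sigma$-algebra. $\Lambda$ is the set of functions $\mathcal{X}\to(0,\infty)$, and $\Lambda^n$ its $n$-fold product. A probability measure $P_n$ on $\mathcal{X}^n$ (or a random sequence $(X_1,\ldots,X_n)$ with this distribution) is called $\lambda$-exchangeable, for $\lambda=(\lambda_1,\ldots,\lambda_n)\in\Lambda^n$, if the measure $\overline{P}_n$ defined by $\overline{P}_n(B)=\int_B \frac{dP_n(x_1,\ldots,x_n)}{\prod_{i=1}^n\lambda_i(x_i)}$, $B\subset\mathcal{X}^n$, is an exchangeable probability measure (i.e. invariant under all permutations of the $n$ coordinates). For a probability measure $\mu$ on $\mathcal{X}$, let $T_i\mu$ be the probability measure $T_i\mu(dx)=\lambda_i(x)\mu(dx)/\int\lambda_i\,d\mu$. A weighted i.i.d. distribution on $\mathcal{X}^n$ is a product measure $\otimes_{i=1}^n T_i\mu$ with $\mu$ a probability measure on $\mathcal{X}$. A mixture of weighted i.i.d. distributions on $\mathcal{X}^n$ is a measure of the form $\int_{\mathcal{P}(\mathcal{X})}\otimes_{i=1}^n T_i\mu\,\Pi(d\mu)$ with $\Pi$ a Borel probability measure on the space $\mathcal{P}(\mathcal{X})$ of probability measures on $\mathcal{X}$. The total variation distance is $|P-Q|_{TV}:=\sup_A|P(A)-Q(A)|$ over measurable sets $A$. Empty products equal $1$. *)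

theory Defs
  imports "HOL-Probability.Probability"
begin

text \<open>
  Sequences of length \<open>n\<close> over \<open>X\<close> are the extensional functions on the index set \<open>{1..n}\<close>;
  only the weights \<open>l 1, ..., l n\<close> and their values on \<open>X\<close> matter.
\<close>

abbreviation seq_space :: "nat \<Rightarrow> 'a set \<Rightarrow> (nat \<Rightarrow> 'a) measure" where
  "seq_space n X \<equiv> PiM {1..n} (\<lambda>_. count_space X)"

definition weight_seq :: "nat \<Rightarrow> 'a set \<Rightarrow> (nat \<Rightarrow> 'a \<Rightarrow> real) \<Rightarrow> bool" where
  "weight_seq n X l \<longleftrightarrow> (\<forall>i\<in>{1..n}. \<forall>x\<in>X. l i x > 0)"

definition exchangeable :: "nat \<Rightarrow> 'a set \<Rightarrow> (nat \<Rightarrow> 'a) measure \<Rightarrow> bool" where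
  "exchangeable n X P \<longleftrightarrow>
     prob_space P \<and> sets P = sets (seq_space n X) \<and>
     (\<forall>p. p permutes {1..n} \<longrightarrow>
        distr P (seq_space n X) (\<lambda>x. restrict (\<lambda>i. x (p i)) {1..n}) = P)"

definition weighted_exchangeable ::
    "nat \<Rightarrow> 'a set \<Rightarrow> (nat \<Rightarrow> 'a \<Rightarrow> real) \<Rightarrow> (nat \<Rightarrow> 'a) measure \<Rightarrow> bool" where
  "weighted_exchangeable n X l P \<longleftrightarrow>
     prob_space P \<and> sets P = sets (seq_space n X) \<and>
     exchangeable n X (density P (\<lambda>x. ennreal (1 / (\<Prod>i=1..n. l i (x i)))))"

definition tilt :: "('a \<Rightarrow> real) \<Rightarrow> 'a measure \<Rightarrow> 'a measure" where
  "tilt w \<mu> = density \<mu> (\<lambda>x. ennreal (w x / (\<integral>y. w y \<partial>\<mu>)))"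

definition weighted_iid ::
    "nat \<Rightarrow> (nat \<Rightarrow> 'a \<Rightarrow> real) \<Rightarrow> 'a measure \<Rightarrow> (nat \<Rightarrow> 'a) measure" where
  "weighted_iid n l \<mu> = PiM {1..n} (\<lambda>i. tilt (l i) \<mu>)"

text \<open>
  The measurable space of probability measures on \<open>X\<close> is \<open>prob_algebra (count_space X)\<close>, whose
  \<open>\<sigma>\<close>-algebra is generated by the evaluations \<open>\<mu> \<mapsto> \<mu> A\<close>. For finite \<open>X\<close> (where \<open>\<P>(X)\<close> is a
  simplex with coordinates \<open>\<mu> {x}\<close>) this is the Borel \<open>\<sigma>\<close>-algebra of \<open>\<P>(X)\<close>.
  The Giry bind \<open>\<nu> \<bind> K\<close> is the mixture \<open>A \<mapsto> \<integral> K \<mu> A d\<nu>(\<mu>)\<close>.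
\<close>

definition weighted_iid_mixture ::
    "nat \<Rightarrow> 'a set \<Rightarrow> (nat \<Rightarrow> 'a \<Rightarrow> real) \<Rightarrow> (nat \<Rightarrow> 'a) measure \<Rightarrow> bool" where
  "weighted_iid_mixture n X l Q \<longleftrightarrow>
     (\<exists>\<nu> \<in> space (prob_algebra (prob_algebra (count_space X))). Q = \<nu> \<bind> weighted_iid n l)"

definition first_marginal ::
    "nat \<Rightarrow> 'a set \<Rightarrow> (nat \<Rightarrow> 'a) measure \<Rightarrow> (nat \<Rightarrow> 'a) measure" where
  "first_marginal k X P = distr P (seq_space k X) (\<lambda>x. restrict x {1..k})"

text \<open>Intended for probability measures \<open>P\<close> and \<open>Q\<close> with the same \<open>\<sigma>\<close>-algebra.\<close>

definition tv_dist :: "'b measure \<Rightarrow> 'b measure \<Rightarrow> real" where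
  "tv_dist P Q = (SUP A\<in>sets P. \<bar>measure P A - measure Q A\<bar>)"

definition weight_ratio :: "'a set \<Rightarrow> ('a \<Rightarrow> real) \<Rightarrow> real" where
  "weight_ratio X w = Min (w ` X) / Max (w ` X)"

lemma tilt_prob_algebra:
  assumes "finite X" "\<And>x. x \<in> X \<Longrightarrow> 0 < w x" "\<mu> \<in> space (prob_algebra (count_space X))"
  shows "tilt w \<mu> \<in> space (prob_algebra (count_space X))"
    and "\<And>x. x \<in> X \<Longrightarrow> emeasure (tilt w \<mu>) {x} = ennreal (w x / (\<integral>y. w y \<partial>\<mu>)) * emeasure \<mu> {x}"
proof -
  interpret prob_space \<mu> using assms(3) by (simp add: space_prob_algebra)
  have s: "sets \<mu> = Pow X" using assms(3) by (simp add: space_prob_algebra)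
  have sp: "space \<mu> = X" using s by (metis sets_eq_imp_space_eq sets_count_space space_count_space)
  have m: "f \<in> borel_measurable \<mu>" for f :: "'a \<Rightarrow> real"
    using s sp by (auto simp: measurable_def)
  have m2: "f \<in> borel_measurable \<mu>" for f :: "'a \<Rightarrow> ennreal"
    using s sp by (auto simp: measurable_def)
  have ne: "X \<noteq> {}" using not_empty sp by simp
  define d where "d = Min (w ` X)"
  have d: "d > 0" "\<And>x. x \<in> X \<Longrightarrow> d \<le> w x"
    using assms ne by (auto simp: d_def)
  have i: "integrable \<mu> w"
    by (rule integrable_const_bound[where B="Max (w ` X)"])
       (use assms ne sp m in \<open>auto intro!: AE_I2 simp: abs_of_pos\<close>)
  have "(\<integral>y. d \<partial>\<mu>) \<le> (\<integral>y. w y \<partial>\<mu>)"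
    by (rule integral_mono) (use i d sp in auto)
  then have pos: "(\<integral>y. w y \<partial>\<mu>) > 0" using d by (simp add: prob_space)
  have "emeasure (tilt w \<mu>) X = (\<integral>\<^sup>+x. ennreal (w x / (\<integral>y. w y \<partial>\<mu>)) \<partial>\<mu>)"
    unfolding tilt_def by (subst emeasure_density) (use s sp m2 in \<open>auto intro!: nn_integral_cong\<close>)
  also have "\<dots> = ennreal (\<integral>x. w x / (\<integral>y. w y \<partial>\<mu>) \<partial>\<mu>)"
    by (rule nn_integral_eq_integral) (use i pos sp assms(2) in \<open>auto intro!: AE_I2 less_imp_le\<close>)
  also have "\<dots> = 1" using pos by simp
  finally have "prob_space (tilt w \<mu>)" by (intro prob_spaceI) (simp add: tilt_def sp)
  then show "tilt w \<mu> \<in> space (prob_algebra (count_space X))"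
    by (simp add: space_prob_algebra tilt_def s)
  show "emeasure (tilt w \<mu>) {x} = ennreal (w x / (\<integral>y. w y \<partial>\<mu>)) * emeasure \<mu> {x}" if "x \<in> X" for x
  proof -
    have "emeasure (tilt w \<mu>) {x} = (\<integral>\<^sup>+ y. ennreal (w x / (\<integral>y. w y \<partial>\<mu>)) * indicator {x} y \<partial>\<mu>)"
      unfolding tilt_def by (subst emeasure_density) (use s m2 that in \<open>auto intro!: nn_integral_cong split: split_indicator\<close>)
    then show ?thesis using that s by (simp add: nn_integral_cmult_indicator)
  qed
qed

text \<open>The kernel in \<open>weighted_iid_mixture\<close> is measurable, so that the bind there is a genuine mixture.\<close>

lemma measurable_weighted_iid:
  assumes X: "finite X" and l: "weight_seq n X l"
  shows "weighted_iid n l \<in> prob_algebra (count_space X) \<rightarrow>\<^sub>M prob_algebra (seq_space n X)"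
proof -
  have C: "seq_space n X = count_space (PiE {1..n} (\<lambda>_. X))"
    using X by (intro count_space_PiM_finite) (auto intro: countable_finite)
  let ?S = "PiE {1..n} (\<lambda>_. X)"
  have fS: "finite ?S" using X by (intro finite_PiE) auto
  let ?G = "insert {} ((\<lambda>f. {f}) ` ?S)"
  have G: "Pow ?S = sigma_sets ?S ?G"
  proof (intro equalityI subsetI)
    fix A assume "A \<in> Pow ?S"
    then have AS: "A \<subseteq> ?S" by auto
    then have "finite A" using fS finite_subset by blast
    then have "(\<Union>f\<in>A. {f}) \<in> sigma_sets ?S ?G"
      using AS by (intro sigma_sets_UNION countable_finite) (auto intro!: sigma_sets.Basic)
    then show "A \<in> sigma_sets ?S ?G" by simp
  next
    fix A assume "A \<in> sigma_sets ?S ?G"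
    then show "A \<in> Pow ?S" by (rule sigma_sets_into_sp[rotated, THEN PowI]) auto
  qed
  have P: "weighted_iid n l \<mu> \<in> space (prob_algebra (seq_space n X))"
    "\<And>f. f \<in> ?S \<Longrightarrow> emeasure (weighted_iid n l \<mu>) {f} = (\<Prod>i=1..n. ennreal (l i (f i) / (\<integral>y. l i y \<partial>\<mu>)) * emeasure \<mu> {f i})"
    if \<mu>: "\<mu> \<in> space (prob_algebra (count_space X))" for \<mu>
  proof -
    have t: "tilt (l i) \<mu> \<in> space (prob_algebra (count_space X))" if "i \<in> {1..n}" for i
      using tilt_prob_algebra(1)[OF X _ \<mu>, of "l i"] l that by (auto simp: weight_seq_def)
    have 1: "weighted_iid n l \<mu> = PiM {1..n} (\<lambda>i. if i \<in> {1..n} then tilt (l i) \<mu> else \<mu>)"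
      unfolding weighted_iid_def by (rule PiM_cong) auto
    have pr: "prob_space (if i \<in> {1..n} then tilt (l i) \<mu> else \<mu>)" for i
      using t[of i] \<mu> by (cases "i \<in> {1..n}") (simp_all add: space_prob_algebra)
    interpret product_sigma_finite "\<lambda>i. if i \<in> {1..n} then tilt (l i) \<mu> else \<mu>"
      unfolding product_sigma_finite_def by (intro allI prob_space_imp_sigma_finite pr)
    have "prob_space (weighted_iid n l \<mu>)"
      unfolding 1 by (rule prob_space_PiM) (rule pr)
    moreover have "sets (weighted_iid n l \<mu>) = sets (seq_space n X)"
      unfolding weighted_iid_def by (rule sets_PiM_cong) (use t in \<open>simp_all add: space_prob_algebra\<close>)
    ultimately show "weighted_iid n l \<mu> \<in> space (prob_algebra (seq_space n X))"
      by (simp add: space_prob_algebra)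
    fix f assume f: "f \<in> ?S"
    show "emeasure (weighted_iid n l \<mu>) {f} = (\<Prod>i=1..n. ennreal (l i (f i) / (\<integral>y. l i y \<partial>\<mu>)) * emeasure \<mu> {f i})"
    proof -
      have ext: "f \<in> extensional {1..n}" and fX: "\<And>i. i \<in> {1..n} \<Longrightarrow> f i \<in> X" using f by (auto simp: PiE_def)
      have "{f} = PiE {1..n} (\<lambda>i. {f i})" using PiE_singleton[OF ext] by simp
      moreover have "emeasure (weighted_iid n l \<mu>) (PiE {1..n} (\<lambda>i. {f i}))
          = (\<Prod>i=1..n. emeasure (if i \<in> {1..n} then tilt (l i) \<mu> else \<mu>) {f i})"
        unfolding 1 by (rule emeasure_PiM) (use fX t in \<open>simp_all add: space_prob_algebra\<close>)
      ultimately have "emeasure (weighted_iid n l \<mu>) {f}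
          = (\<Prod>i=1..n. emeasure (if i \<in> {1..n} then tilt (l i) \<mu> else \<mu>) {f i})" by simp
      also have "\<dots> = (\<Prod>i=1..n. ennreal (l i (f i) / (\<integral>y. l i y \<partial>\<mu>)) * emeasure \<mu> {f i})"
      proof (rule prod.cong)
        fix i assume i: "i \<in> {1..n}"
        then have "\<And>x. x \<in> X \<Longrightarrow> 0 < l i x" using l by (simp add: weight_seq_def)
        from tilt_prob_algebra(2)[OF X this \<mu> fX[OF i]] i
        show "emeasure (if i \<in> {1..n} then tilt (l i) \<mu> else \<mu>) {f i}
            = ennreal (l i (f i) / (\<integral>y. l i y \<partial>\<mu>)) * emeasure \<mu> {f i}" by simp
      qed simp
      finally show ?thesis .
    qed
  qed
  show ?thesis
  proof (rule measurable_prob_algebra_generated[where G="?G" and \<Omega>="?S"])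
    show "sets (seq_space n X) = sigma_sets ?S ?G" unfolding C using G by simp
    show "Int_stable ?G" by (auto simp: Int_stable_def)
    show "?G \<subseteq> Pow ?S" by auto
    show "prob_space (weighted_iid n l \<mu>)" "sets (weighted_iid n l \<mu>) = sets (seq_space n X)" if "\<mu> \<in> space (prob_algebra (count_space X))" for \<mu>
      using P(1)[OF that] by (auto simp: space_prob_algebra)
    fix A assume A: "A \<in> ?G"
    show "(\<lambda>\<mu>. emeasure (weighted_iid n l \<mu>) A) \<in> borel_measurable (prob_algebra (count_space X))"
    proof (cases "A = {}")
      case False
      then obtain f where f: "A = {f}" "f \<in> ?S" using A by auto
      have fi: "f i \<in> X" if "i \<in> {1..n}" for i using f that by auto
      have e: "(\<lambda>\<mu>. emeasure \<mu> {f i}) \<in> borel_measurable (prob_algebra (count_space X))" if "i \<in> {1..n}" for i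
        using fi[OF that] unfolding prob_algebra_def
        by (intro measurable_restrict_space1 measurable_emeasure_subprob_algebra) auto
      have g: "(\<lambda>\<mu>. \<integral>y. l i y \<partial>\<mu>) \<in> borel_measurable (prob_algebra (count_space X))" for i
        unfolding prob_algebra_def
        by (intro measurable_restrict_space1 integral_measurable_subprob_algebra) auto
      have "(\<lambda>\<mu>. \<Prod>i=1..n. ennreal (l i (f i) / (\<integral>y. l i y \<partial>\<mu>)) * emeasure \<mu> {f i}) \<in> borel_measurable (prob_algebra (count_space X))"
        using e g by (intro borel_measurable_prod_ennreal borel_measurable_times_ennreal measurable_compose[OF _ measurable_ennreal] borel_measurable_divide) auto
      then show ?thesis using P(2)[OF _ f(2)] f(1) by (simp cong: measurable_cong)
    qed simp
  qed
qed

end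

theory Submission
  imports Defs
begin

text \<open>
  Divide the mass of every sequence by its weight: by hypothesis the result is the mass function of
  an exchangeable measure. Such a measure is a mixture of urns: choose a sequence \<open>y\<close>, then arrange
  its entries in a uniformly random order. Multiplying by the weights again, \<open>P\<close> is a mixture, with
  some probabilities \<open>\<pi> y\<close>, of weighted urns, in which an arrangement has probability proportional to
  its weight. The measure \<open>Q\<close> is the mixture, with the same probabilities \<open>\<pi> y\<close>, of the weighted
  i.i.d. distributions of the empirical measures of the sequences \<open>y\<close>. The total variation distance of two
  mixtures with equal mixing probabilities is at most the largest distance of their components, so
  it suffices to compare one weighted urn with one weighted i.i.d. distribution on events that depend
  on the first \<open>k\<close> coordinates (\<open>weighted_urn_vs_weighted_iid\<close>).

  That comparison has three parts. Let \<open>R\<close> be the product of the first \<open>k\<close> weight ratios, \<open>R'\<close> the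
  product of the others, and \<open>s = R' powr (-1/2)\<close>.

  The weights of the last \<open>n - k\<close> coordinates form a density whose largest and smallest values have
  ratio at most \<open>s\<^sup>2\<close>. Removing such a density changes the probability of an event by at most
  \<open>(s - 1) / (s + 1)\<close> (\<open>tilt_event_abs_le\<close>).

  The weights of the first \<open>k\<close> coordinates are applied to both laws. Reweighting two laws by the same
  function multiplies their total variation distance by at most the ratio of the largest to the
  smallest weight, which is at most \<open>1 / R\<close> (\<open>weighted_event_abs_le\<close>). As \<open>R \<le> 1\<close>, this factor is at most
  \<open>(3 - R) / (2 * R)\<close>.

  Without weights, the first \<open>k\<close> draws with and without replacement from \<open>n\<close> balls of \<open>c\<close>
  colours differ by at most \<open>c * k / n\<close> in total variation
  (\<open>sampling_without_replacement_vs_iid\<close>). This is a bound of Diaconis and Freedman; the proof here is by relative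
  entropy. By the chain rule the relative entropy is a sum of contributions of single draws. Each
  of them is at most the expected chi-square distance between the composition of the remaining urn and
  that of the full urn, which is a variance for sampling without replacement and hence at most
  \<open>(c - 1) * i / (n - i)\<^sup>2\<close> after \<open>i\<close> draws. The sum is of order \<open>(c - 1) * (k / n)\<^sup>2\<close>, and the square of the
  total variation distance is at most the relative entropy.
\<close>

section \<open>Averages over uniform random permutations\<close>
definition perm_avg :: "nat \<Rightarrow> ((nat \<Rightarrow> nat) \<Rightarrow> real) \<Rightarrow> real" where
  "perm_avg n f = (\<Sum>\<sigma> | \<sigma> permutes {1..n}. f \<sigma>) / fact n"

lemma perm_avg_cong:
  "(\<And>\<sigma>. \<sigma> permutes {1..n} \<Longrightarrow> f \<sigma> = g \<sigma>) \<Longrightarrow> perm_avg n f = perm_avg n g"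
  unfolding perm_avg_def by (intro arg_cong2[where f="(/)"] sum.cong) auto

lemma perm_avg_mono:
  "(\<And>\<sigma>. \<sigma> permutes {1..n} \<Longrightarrow> f \<sigma> \<le> g \<sigma>) \<Longrightarrow> perm_avg n f \<le> perm_avg n g"
  unfolding perm_avg_def by (intro divide_right_mono sum_mono) auto

lemma perm_avg_const [simp]: "perm_avg n (\<lambda>_. c) = c"
  unfolding perm_avg_def by (simp add: card_permutations[OF refl])

lemma perm_avg_add: "perm_avg n (\<lambda>\<sigma>. f \<sigma> + g \<sigma>) = perm_avg n f + perm_avg n g"
  unfolding perm_avg_def by (simp add: sum.distrib add_divide_distrib)

lemma perm_avg_cmult: "perm_avg n (\<lambda>\<sigma>. c * f \<sigma>) = c * perm_avg n f"
  unfolding perm_avg_def by (simp add: sum_distrib_left)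

lemma perm_avg_sum: "perm_avg n (\<lambda>\<sigma>. \<Sum>i\<in>I. f i \<sigma>) = (\<Sum>i\<in>I. perm_avg n (f i))"
  unfolding perm_avg_def by (subst sum.swap) (simp add: sum_divide_distrib)

lemma perm_avg_nonneg: "(\<And>\<sigma>. \<sigma> permutes {1..n} \<Longrightarrow> 0 \<le> f \<sigma>) \<Longrightarrow> 0 \<le> perm_avg n f"
  using perm_avg_mono[of n "\<lambda>_. 0" f] by simp

lemma perm_avg_pos:
  assumes "\<And>\<sigma>. \<sigma> permutes {1..n} \<Longrightarrow> 0 \<le> f \<sigma>" "\<sigma>0 permutes {1..n}" "0 < f \<sigma>0"
  shows "0 < perm_avg n f"
  unfolding perm_avg_def using assms
  by (intro divide_pos_pos sum_pos2[where i=\<sigma>0]) (auto simp: finite_permutations)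

lemma perm_avg_compose:
  assumes "\<tau> permutes {1..n}"
  shows "perm_avg n (\<lambda>\<sigma>. f (\<sigma> \<circ> \<tau>)) = perm_avg n f"
  unfolding perm_avg_def using sum_permutations_compose_right[OF assms, of f]
  by (simp add: o_def)

text \<open>
  Transpositions make all positions equally distributed, and the sum over all positions does not
  depend on the permutation.
\<close>
lemma perm_avg_point:
  assumes "j \<in> {1..n}"
  shows "perm_avg n (\<lambda>\<sigma>. h (\<sigma> j)) = (\<Sum>i=1..n. h i) / real n"
proof -
  have "perm_avg n (\<lambda>\<sigma>. h (\<sigma> i)) = perm_avg n (\<lambda>\<sigma>. h (\<sigma> j))" if "i \<in> {1..n}" for i
    using perm_avg_compose[OF permutes_swap_id[OF that assms], of "\<lambda>\<sigma>. h (\<sigma> j)"] by simp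
  then have "(\<Sum>i=1..n. perm_avg n (\<lambda>\<sigma>. h (\<sigma> i))) = (\<Sum>i=1..n. perm_avg n (\<lambda>\<sigma>. h (\<sigma> j)))"
    by (rule sum.cong[OF refl])
  then have "real n * perm_avg n (\<lambda>\<sigma>. h (\<sigma> j)) = perm_avg n (\<lambda>\<sigma>. \<Sum>i=1..n. h (\<sigma> i))"
    by (simp only: perm_avg_sum) simp
  also have "\<dots> = perm_avg n (\<lambda>_. \<Sum>i=1..n. h i)"
    by (rule perm_avg_cong) (metis (no_types, lifting) comp_apply sum.cong sum.permute)
  finally show ?thesis using assms by (simp add: field_simps)
qed

text \<open>
  Once the first \<open>k\<close> values are fixed, position \<open>Suc k\<close> and every later position are
  interchangeable, so position \<open>Suc k\<close> may be replaced by the average over the tail. This stands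
  in for conditioning on the first \<open>k\<close> draws from the urn.
\<close>
lemma perm_avg_next_position:
  assumes "k < n"
    and "\<And>\<sigma> \<sigma>' m. (\<And>i. i \<in> {1..k} \<Longrightarrow> \<sigma> i = \<sigma>' i) \<Longrightarrow> f \<sigma> m = f \<sigma>' m"
  shows "real (n - k) * perm_avg n (\<lambda>\<sigma>. f \<sigma> (\<sigma> (Suc k)))
          = perm_avg n (\<lambda>\<sigma>. \<Sum>m=Suc k..n. f \<sigma> (\<sigma> m))"
proof -
  have "perm_avg n (\<lambda>\<sigma>. f \<sigma> (\<sigma> m)) = perm_avg n (\<lambda>\<sigma>. f \<sigma> (\<sigma> (Suc k)))"
    if m: "m \<in> {Suc k..n}" for m
  proof -
    have 1: "Transposition.transpose (Suc k) m permutes {1..n}"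
      using m assms(1) by (intro permutes_swap_id) auto
    have "f (\<sigma> \<circ> Transposition.transpose (Suc k) m) = f \<sigma>" for \<sigma>
      using m by (intro ext assms(2)) (auto simp: Transposition.transpose_def)
    with perm_avg_compose[OF 1, of "\<lambda>\<sigma>. f \<sigma> (\<sigma> m)"] show ?thesis by simp
  qed
  then have "(\<Sum>m=Suc k..n. perm_avg n (\<lambda>\<sigma>. f \<sigma> (\<sigma> m)))
      = (\<Sum>m=Suc k..n. perm_avg n (\<lambda>\<sigma>. f \<sigma> (\<sigma> (Suc k))))"
    by (rule sum.cong[OF refl])
  then show ?thesis by (simp only: perm_avg_sum) simp
qed

text \<open>
  Since the values \<open>h (\<sigma> m)\<close> sum to \<open>0\<close>, the covariances of position \<open>i\<close> with all positions
  (itself included) add up to \<open>0\<close>. The covariances with the other positions are all equal, so each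
  of them is a negative multiple of the variance.
\<close>
lemma perm_avg_neg_correlation:
  assumes i: "i \<in> {1..n}" and j: "j \<in> {1..n}" and "i \<noteq> j" and h: "(\<Sum>i=1..n. h i) = 0"
  shows "perm_avg n (\<lambda>\<sigma>. h (\<sigma> i) * h (\<sigma> j)) \<le> 0"
proof -
  have same: "perm_avg n (\<lambda>\<sigma>. h (\<sigma> i) * h (\<sigma> m)) = perm_avg n (\<lambda>\<sigma>. h (\<sigma> i) * h (\<sigma> j))"
    if "m \<in> {1..n} - {i}" for m
    using perm_avg_compose[OF permutes_swap_id[of m "{1..n}" j], of "\<lambda>\<sigma>. h (\<sigma> i) * h (\<sigma> j)"]
      that assms by (simp add: Transposition.transpose_def)
  have "0 = perm_avg n (\<lambda>\<sigma>. h (\<sigma> i) * (\<Sum>m=1..n. h (\<sigma> m)))"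
  proof -
    have "(\<Sum>m=1..n. h (\<sigma> m)) = 0" if "\<sigma> permutes {1..n}" for \<sigma>
      using sum.permute[OF that, of h] h by (simp add: o_def)
    then have "perm_avg n (\<lambda>\<sigma>. h (\<sigma> i) * (\<Sum>m=1..n. h (\<sigma> m))) = perm_avg n (\<lambda>_. 0)"
      by (intro perm_avg_cong) simp
    then show ?thesis by simp
  qed
  also have "\<dots> = (\<Sum>m=1..n. perm_avg n (\<lambda>\<sigma>. h (\<sigma> i) * h (\<sigma> m)))"
    by (simp add: sum_distrib_left perm_avg_sum)
  also have "\<dots> = perm_avg n (\<lambda>\<sigma>. h (\<sigma> i) * h (\<sigma> i))
      + (\<Sum>m\<in>{1..n} - {i}. perm_avg n (\<lambda>\<sigma>. h (\<sigma> i) * h (\<sigma> m)))"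
    using i by (subst sum.remove[of _ i]) auto
  also have "\<dots> = perm_avg n (\<lambda>\<sigma>. h (\<sigma> i) * h (\<sigma> i))
      + real (n - 1) * perm_avg n (\<lambda>\<sigma>. h (\<sigma> i) * h (\<sigma> j))"
    using i sum.cong[OF refl same, of "{1..n} - {i}" "\<lambda>m. m"] by simp
  finally have "real (n - 1) * perm_avg n (\<lambda>\<sigma>. h (\<sigma> i) * h (\<sigma> j)) \<le> 0"
    using perm_avg_nonneg[of n "\<lambda>\<sigma>. h (\<sigma> i) * h (\<sigma> i)"] by simp
  moreover have "n - 1 > 0" using assms by auto
  ultimately show ?thesis by (simp add: mult_le_0_iff)
qed

text \<open>
  The variance of a sum drawn without replacement is at most the variance of the sum drawn with
  replacement, because the off-diagonal covariances are nonpositive.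
\<close>
lemma perm_avg_square_sum_le:
  assumes "k \<le> n" and h: "(\<Sum>i=1..n. h i) = 0"
  shows "perm_avg n (\<lambda>\<sigma>. (\<Sum>i=1..k. h (\<sigma> i))\<^sup>2) \<le> real k / real n * (\<Sum>i=1..n. (h i)\<^sup>2)"
proof -
  have "perm_avg n (\<lambda>\<sigma>. (\<Sum>i=1..k. h (\<sigma> i))\<^sup>2)
      = (\<Sum>i=1..k. \<Sum>j=1..k. perm_avg n (\<lambda>\<sigma>. h (\<sigma> i) * h (\<sigma> j)))"
    by (simp add: power2_eq_square sum_product perm_avg_sum)
  also have "\<dots> \<le> (\<Sum>i=1..k. \<Sum>j=1..k. if i = j then perm_avg n (\<lambda>\<sigma>. (h (\<sigma> i))\<^sup>2) else 0)"
    using assms by (intro sum_mono) (auto simp: power2_eq_square intro!: perm_avg_neg_correlation)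
  also have "\<dots> = (\<Sum>i=1..k. perm_avg n (\<lambda>\<sigma>. (h (\<sigma> i))\<^sup>2))"
    by simp
  also have "\<dots> = (\<Sum>i=1..k. (\<Sum>i=1..n. (h i)\<^sup>2) / real n)"
    using assms(1) by (intro sum.cong refl perm_avg_point) auto
  finally show ?thesis by simp
qed

section \<open>Comparing finite probability vectors on events\<close>
text \<open>
  Pinsker's inequality with constant \<open>1\<close> in place of \<open>1/2\<close>. It goes through the Hellinger affinity
  \<open>b = (\<Sum>z\<in>T. sqrt (u z * p z))\<close>: Cauchy-Schwarz bounds the square of the event difference by
  \<open>1 - b\<^sup>2\<close>, which is at most \<open>2 * (1 - b)\<close>, and \<open>ln t \<le> t - 1\<close> at \<open>t = sqrt (p z / u z)\<close> bounds
  \<open>2 * (1 - b)\<close> by the relative entropy.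
\<close>
lemma event_diff_sq_le_relative_entropy:
  fixes u p :: "'b \<Rightarrow> real"
  assumes T: "finite T" "A \<subseteq> T"
    and u: "\<And>z. z \<in> T \<Longrightarrow> 0 \<le> u z" "sum u T = 1"
    and p: "\<And>z. z \<in> T \<Longrightarrow> 0 \<le> p z" "sum p T = 1"
    and ac: "\<And>z. z \<in> T \<Longrightarrow> u z > 0 \<Longrightarrow> p z > 0"
  shows "(sum u A - sum p A)\<^sup>2 \<le> (\<Sum>z\<in>T. u z * ln (u z / p z))"
proof -
  define b where "b = (\<Sum>z\<in>T. sqrt (u z) * sqrt (p z))"
  define d where "d = (\<Sum>z\<in>T. \<bar>u z - p z\<bar>)"
  \<comment> \<open>an event and its complement contribute equally to the \<open>L\<^sup>1\<close> distance\<close>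
  have half: "2 * \<bar>sum u A - sum p A\<bar> \<le> d"
  proof -
    have 1: "sum u T = sum u A + sum u (T - A)" "sum p T = sum p A + sum p (T - A)"
      "d = (\<Sum>z\<in>A. \<bar>u z - p z\<bar>) + (\<Sum>z\<in>T - A. \<bar>u z - p z\<bar>)"
      unfolding d_def using sum.subset_diff[OF T(2,1)] by (simp_all add: add.commute)
    have "\<bar>sum u A - sum p A\<bar> \<le> (\<Sum>z\<in>A. \<bar>u z - p z\<bar>)"
      "\<bar>sum u (T - A) - sum p (T - A)\<bar> \<le> (\<Sum>z\<in>T - A. \<bar>u z - p z\<bar>)"
      unfolding sum_subtractf[symmetric] by (rule sum_abs)+
    moreover have "sum u (T - A) - sum p (T - A) = - (sum u A - sum p A)"
      using 1 u(2) p(2) by linarith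
    ultimately have "\<bar>sum u A - sum p A\<bar> \<le> (\<Sum>z\<in>A. \<bar>u z - p z\<bar>)"
      "\<bar>sum u A - sum p A\<bar> \<le> (\<Sum>z\<in>T - A. \<bar>u z - p z\<bar>)"
      by (simp_all only: abs_minus_cancel)
    then show ?thesis unfolding 1(3) by (rule order_trans[OF eq_refl add_mono, rotated]) simp
  qed
  have sq: "sqrt (u z) * sqrt (u z) = u z" "sqrt (p z) * sqrt (p z) = p z" if "z \<in> T" for z
    using u p that by auto
  have "d = (\<Sum>z\<in>T. \<bar>sqrt (u z) - sqrt (p z)\<bar> * (sqrt (u z) + sqrt (p z)))"
    unfolding d_def
  proof (rule sum.cong[OF refl])
    fix z assume z: "z \<in> T"
    have "u z - p z = (sqrt (u z) - sqrt (p z)) * (sqrt (u z) + sqrt (p z))"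
      using sq[OF z] by (simp add: algebra_simps)
    then show "\<bar>u z - p z\<bar> = \<bar>sqrt (u z) - sqrt (p z)\<bar> * (sqrt (u z) + sqrt (p z))"
      using u(1)[OF z] p(1)[OF z] by (simp add: abs_mult)
  qed
  then have "d\<^sup>2 \<le> (\<Sum>z\<in>T. \<bar>sqrt (u z) - sqrt (p z)\<bar>\<^sup>2) * (\<Sum>z\<in>T. (sqrt (u z) + sqrt (p z))\<^sup>2)"
    by (simp only: Cauchy_Schwarz_ineq_sum)
  also have "(\<Sum>z\<in>T. \<bar>sqrt (u z) - sqrt (p z)\<bar>\<^sup>2) = (\<Sum>z\<in>T. u z + p z - 2 * (sqrt (u z) * sqrt (p z)))"
    by (intro sum.cong refl) (simp add: power2_diff u(1) p(1))
  also have "\<dots> = 2 - 2 * b"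
    by (simp add: sum.distrib sum_subtractf sum_distrib_left u p b_def)
  also have "(\<Sum>z\<in>T. (sqrt (u z) + sqrt (p z))\<^sup>2) = (\<Sum>z\<in>T. u z + p z + 2 * (sqrt (u z) * sqrt (p z)))"
    by (intro sum.cong refl) (simp add: power2_sum u(1) p(1))
  also have "\<dots> = 2 + 2 * b"
    by (simp add: sum.distrib sum_distrib_left u p b_def)
  finally have d2: "d\<^sup>2 \<le> 4 * (1 - b\<^sup>2)" by (simp add: power2_eq_square algebra_simps)
  have "u z - sqrt (u z) * sqrt (p z) \<le> u z * ln (u z / p z) / 2" if z: "z \<in> T" for z
  proof (cases "u z = 0")
    case False
    then have up: "u z > 0" "p z > 0" using u(1)[OF z] ac[OF z] by auto
    have "ln (sqrt (p z / u z)) \<le> sqrt (p z / u z) - 1"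
      using up by (intro ln_le_minus_one) auto
    then have "u z * (ln (p z / u z) / 2) \<le> u z * (sqrt (p z / u z) - 1)"
      using up by (simp add: ln_sqrt)
    moreover have "u z * sqrt (p z / u z) = sqrt (u z) * sqrt (p z)"
      using up sq[OF z] by (simp add: real_sqrt_divide field_simps)
    moreover have "ln (p z / u z) = - ln (u z / p z)" using up by (simp add: ln_div)
    ultimately show ?thesis unfolding right_diff_distrib mult_1_right by simp
  qed simp
  then have "(\<Sum>z\<in>T. u z - sqrt (u z) * sqrt (p z)) \<le> (\<Sum>z\<in>T. u z * ln (u z / p z) / 2)"
    by (intro sum_mono)
  then have D: "2 * (1 - b) \<le> (\<Sum>z\<in>T. u z * ln (u z / p z))"
    unfolding sum_subtractf sum_divide_distrib[symmetric] u(2) b_def[symmetric] by simp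
  have "(2 * \<bar>sum u A - sum p A\<bar>)\<^sup>2 \<le> d\<^sup>2" using half by (intro power_mono) auto
  with d2 have "(sum u A - sum p A)\<^sup>2 \<le> 1 - b\<^sup>2" by (simp add: power_mult_distrib)
  also have "\<dots> \<le> 2 * (1 - b)" using zero_le_power2[of "1 - b"]
    by (simp add: power2_eq_square algebra_simps)
  finally show ?thesis using D by simp
qed

text \<open>
  Let \<open>p\<close> and \<open>q\<close> be the masses of \<open>A\<close> and of its complement. Reweighting by \<open>h\<close> raises the
  probability of \<open>A\<close> most if \<open>h\<close> is as large as possible (\<open>m * s\<^sup>2\<close>) on \<open>A\<close> and as small as possible
  (\<open>m\<close>) off it. The gain \<open>s\<^sup>2 * p / (s\<^sup>2 * p + q) - p / (p + q)\<close> is largest at \<open>q = s * p\<close>, where it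
  equals \<open>(s - 1) / (s + 1)\<close>.
\<close>
lemma tilt_event_le:
  fixes h f :: "'b \<Rightarrow> real"
  assumes T: "finite T" "A \<subseteq> T"
    and f: "\<And>z. z \<in> T \<Longrightarrow> 0 \<le> f z" "sum f T > 0"
    and h: "\<And>z. z \<in> T \<Longrightarrow> m \<le> h z" "\<And>z. z \<in> T \<Longrightarrow> h z \<le> m * s\<^sup>2" and m: "m > 0" and s: "1 \<le> s"
  shows "(\<Sum>z\<in>A. f z * h z) / (\<Sum>z\<in>T. f z * h z) - sum f A / sum f T \<le> (s - 1) / (s + 1)"
proof -
  define a b where "a = (\<Sum>z\<in>A. f z * h z)" and "b = (\<Sum>z\<in>T - A. f z * h z)"
  define p q where "p = sum f A" and "q = sum f (T - A)"
  have sp: "(\<Sum>z\<in>T. f z * h z) = a + b" "sum f T = p + q"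
    unfolding a_def b_def p_def q_def using sum.subset_diff[OF T(2,1)] by (simp_all add: add.commute)
  have nn: "p \<ge> 0" "q \<ge> 0" unfolding p_def q_def using f T by (auto intro!: sum_nonneg)
  have pq: "p + q > 0" using f sp by simp
  have au: "a \<le> m * s\<^sup>2 * p" unfolding a_def p_def sum_distrib_left
    using T f(1) h by (intro sum_mono) (auto simp: mult.commute intro!: mult_left_mono)
  have bl: "m * q \<le> b" unfolding b_def q_def sum_distrib_left
    using T f(1) h by (intro sum_mono) (auto simp: mult.commute[of m] intro!: mult_left_mono)
  have al: "m * p \<le> a" unfolding a_def p_def sum_distrib_left
    using T f(1) h by (intro sum_mono) (auto simp: mult.commute[of m] intro!: mult_left_mono)
  have ab: "a + b > 0" using al bl mult_pos_pos[OF m pq] by (simp add: algebra_simps)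
  have s0: "s > 0" "s\<^sup>2 \<ge> 1" using s by auto
  have s1: "s\<^sup>2 * p + q > 0" 
    using nn pq s0 by (cases "p = 0") (auto intro!: add_pos_nonneg)
  have "a / (a + b) \<le> s\<^sup>2 * p / (s\<^sup>2 * p + q)"
  proof -
    have "a * q \<le> s\<^sup>2 * p * b"
    proof -
      have "a * q \<le> m * s\<^sup>2 * p * q" using au nn by (intro mult_right_mono) auto
      also have "\<dots> = s\<^sup>2 * p * (m * q)" by simp
      also have "\<dots> \<le> s\<^sup>2 * p * b" using bl nn by (intro mult_left_mono) auto
      finally show ?thesis .
    qed
    then show ?thesis using ab s1 by (simp add: divide_simps) (simp add: algebra_simps)
  qed
  moreover have "s\<^sup>2 * p / (s\<^sup>2 * p + q) - p / (p + q) \<le> (s - 1) / (s + 1)"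
  proof -
    have "s\<^sup>2 * p / (s\<^sup>2 * p + q) - p / (p + q) = (s - 1) * (s + 1) * p * q / ((s\<^sup>2 * p + q) * (p + q))"
      using s1 pq by (simp add: divide_simps) (simp add: algebra_simps power2_eq_square)
    also have "\<dots> \<le> (s - 1) / (s + 1)"
    proof -
      \<comment> \<open>the difference of the two sides is \<open>(s * p - q)\<^sup>2\<close>\<close>
      have "(s + 1)\<^sup>2 * (p * q) \<le> (s\<^sup>2 * p + q) * (p + q)"
        using zero_le_power2[of "s * p - q"] by (simp add: power2_eq_square algebra_simps)
      from mult_left_mono[OF this, of "s - 1"] show ?thesis
        using s s1 pq by (simp add: divide_simps) (simp add: power2_eq_square mult_ac)
    qed
    finally show ?thesis .
  qed
  ultimately show ?thesis unfolding sp p_def[symmetric] a_def[symmetric] by linarith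
qed

lemma tilt_event_abs_le:
  fixes h f :: "'b \<Rightarrow> real"
  assumes T: "finite T" "A \<subseteq> T"
    and f: "\<And>z. z \<in> T \<Longrightarrow> 0 \<le> f z" "sum f T > 0"
    and h: "\<And>z. z \<in> T \<Longrightarrow> m \<le> h z" "\<And>z. z \<in> T \<Longrightarrow> h z \<le> m * s\<^sup>2" and m: "m > 0" and s: "1 \<le> s"
  shows "\<bar>(\<Sum>z\<in>A. f z * h z) / (\<Sum>z\<in>T. f z * h z) - sum f A / sum f T\<bar> \<le> (s - 1) / (s + 1)"
proof -
  have sp: "(\<Sum>z\<in>T - A. g z) = sum g T - sum g A" for g :: "'b \<Rightarrow> real"
    using sum.subset_diff[OF T(2,1), of g] by simp
  have "(\<Sum>z\<in>T. f z * h z) \<ge> m * sum f T" unfolding sum_distrib_left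
    using f(1) h by (intro sum_mono) (auto simp: mult.commute[of m] intro!: mult_left_mono)
  then have "(\<Sum>z\<in>T. f z * h z) > 0" using mult_pos_pos[OF m f(2)] by linarith
  then show ?thesis
    using tilt_event_le[where h = h, OF assms]
      tilt_event_le[where A = "T - A" and h = h, OF T(1) Diff_subset f h m s] f(2)
    unfolding abs_le_iff sp diff_divide_distrib by simp
qed

text \<open>
  When \<open>u\<close> has the larger normalizing constant, replacing the constant of \<open>p\<close> by that of \<open>u\<close> only
  lowers the probability under \<open>p\<close>. With a common denominator, only the points with \<open>p z \<le> u z\<close>
  count, and there the weight is at most \<open>M\<close>; the denominator is at least \<open>m\<close>.
\<close>
lemma weighted_event_le:
  fixes u p w :: "'b \<Rightarrow> real"
  assumes T: "finite T" "A \<subseteq> T"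
    and d: "\<And>B. B \<subseteq> T \<Longrightarrow> sum u B - sum p B \<le> d"
    and p: "\<And>z. z \<in> T \<Longrightarrow> 0 \<le> p z"
    and u: "\<And>z. z \<in> T \<Longrightarrow> 0 \<le> u z" "sum u T = 1"
    and w: "\<And>z. z \<in> T \<Longrightarrow> m \<le> w z" "\<And>z. z \<in> T \<Longrightarrow> w z \<le> M" and m: "m > 0"
    and le: "(\<Sum>z\<in>T. w z * p z) \<le> (\<Sum>z\<in>T. w z * u z)" and pos: "(\<Sum>z\<in>T. w z * p z) > 0"
  shows "(\<Sum>z\<in>A. w z * u z) / (\<Sum>z\<in>T. w z * u z) - (\<Sum>z\<in>A. w z * p z) / (\<Sum>z\<in>T. w z * p z)
          \<le> d * M / m"
proof -
  define W where "W = (\<Sum>z\<in>T. w z * u z)"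
  define B where "B = {z \<in> A. p z \<le> u z}"
  have fA: "finite A" using T finite_subset by blast
  have W: "m \<le> W"
  proof -
    have "(\<Sum>z\<in>T. m * u z) \<le> W" unfolding W_def using u(1) w by (intro sum_mono mult_right_mono)
    then show ?thesis by (simp add: u(2) flip: sum_distrib_left)
  qed
  have "T \<noteq> {}" using u(2) by auto
  then have M: "M > 0" using w m by (metis all_not_in_conv less_le_trans)
  have d0: "d \<ge> 0" using d[of "{}"] by simp
  have w0: "0 \<le> w z" if "z \<in> T" for z using w(1)[OF that] m by linarith
  have "(\<Sum>z\<in>A. w z * p z) / W \<le> (\<Sum>z\<in>A. w z * p z) / (\<Sum>z\<in>T. w z * p z)"
    using le pos T w0 p unfolding W_def
    by (intro divide_left_mono sum_nonneg mult_nonneg_nonneg mult_pos_pos) auto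
  then have "(\<Sum>z\<in>A. w z * u z) / W - (\<Sum>z\<in>A. w z * p z) / (\<Sum>z\<in>T. w z * p z)
     \<le> (\<Sum>z\<in>A. w z * (u z - p z)) / W"
    by (simp add: right_diff_distrib sum_subtractf diff_divide_distrib)
  also have "\<dots> \<le> (d * M) / W"
  proof (rule divide_right_mono)
    have "(\<Sum>z\<in>A. w z * (u z - p z)) \<le> (\<Sum>z\<in>B. w z * (u z - p z))"
    proof -
      have "(\<Sum>z\<in>A - B. w z * (u z - p z)) \<le> 0"
        using T w0 unfolding B_def by (intro sum_nonpos mult_nonneg_nonpos) auto
      moreover have "(\<Sum>z\<in>A. w z * (u z - p z)) = (\<Sum>z\<in>A - B. w z * (u z - p z)) + (\<Sum>z\<in>B. w z * (u z - p z))"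
        using fA by (intro sum.subset_diff) (auto simp: B_def)
      ultimately show ?thesis by linarith
    qed
    also have "\<dots> \<le> (\<Sum>z\<in>B. M * (u z - p z))"
      using T w(2) by (intro sum_mono mult_right_mono) (auto simp: B_def)
    also have "\<dots> = (sum u B - sum p B) * M" by (simp add: sum_subtractf flip: sum_distrib_left)
    also have "\<dots> \<le> d * M" using T M by (intro mult_right_mono d) (auto simp: B_def)
    finally show "(\<Sum>z\<in>A. w z * (u z - p z)) \<le> d * M" .
  qed (use W m in auto)
  also have "\<dots> \<le> d * M / m" using W m M d0 by (intro divide_left_mono) auto
  finally show ?thesis unfolding W_def .
qed

text \<open>
  Whichever of \<open>u\<close> and \<open>p\<close> has the larger normalizing constant, the one-sided bound applies to \<open>A\<close>
  and to its complement.
\<close>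
lemma weighted_event_abs_le:
  fixes u p w :: "'b \<Rightarrow> real"
  assumes T: "finite T" "A \<subseteq> T"
    and d: "\<And>B. B \<subseteq> T \<Longrightarrow> \<bar>sum u B - sum p B\<bar> \<le> d"
    and p: "\<And>z. z \<in> T \<Longrightarrow> 0 \<le> p z" "sum p T = 1"
    and u: "\<And>z. z \<in> T \<Longrightarrow> 0 \<le> u z" "sum u T = 1"
    and w: "\<And>z. z \<in> T \<Longrightarrow> m \<le> w z" "\<And>z. z \<in> T \<Longrightarrow> w z \<le> M" and m: "m > 0"
  shows "\<bar>(\<Sum>z\<in>A. w z * u z) / (\<Sum>z\<in>T. w z * u z) - (\<Sum>z\<in>A. w z * p z) / (\<Sum>z\<in>T. w z * p z)\<bar>
          \<le> d * M / m"
proof -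
  have pos: "0 < (\<Sum>z\<in>T. w z * v z)" if "\<And>z. z \<in> T \<Longrightarrow> 0 \<le> v z" "sum v T = 1" for v
  proof -
    have "(\<Sum>z\<in>T. m * v z) \<le> (\<Sum>z\<in>T. w z * v z)" using that(1) w by (intro sum_mono mult_right_mono)
    then show ?thesis using m by (simp add: that(2) flip: sum_distrib_left)
  qed
  have sp: "(\<Sum>z\<in>T - A. g z) = sum g T - sum g A" for g :: "'b \<Rightarrow> real"
    using sum.subset_diff[OF T(2,1), of g] by simp
  have d1: "sum u B - sum p B \<le> d" and d2: "sum p B - sum u B \<le> d" if "B \<subseteq> T" for B
    using d[OF that] by auto
  have P: "0 < (\<Sum>z\<in>T. w z * u z)" "0 < (\<Sum>z\<in>T. w z * p z)" using pos u p by auto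
  show ?thesis
  proof (cases "(\<Sum>z\<in>T. w z * p z) \<le> (\<Sum>z\<in>T. w z * u z)")
    case True
    note L = weighted_event_le[OF T(1) _ d1 p(1) u w m True P(2)]
    show ?thesis using L[OF T(2)] L[OF Diff_subset[of T A]] P
      unfolding abs_le_iff sp diff_divide_distrib by simp
  next
    case False
    then have F: "(\<Sum>z\<in>T. w z * u z) \<le> (\<Sum>z\<in>T. w z * p z)" by simp
    note L = weighted_event_le[OF T(1) _ d2 u(1) p w m F P(1)]
    show ?thesis using L[OF T(2)] L[OF Diff_subset[of T A]] P
      unfolding abs_le_iff sp diff_divide_distrib by simp
  qed
qed

section \<open>Sampling with and without replacement\<close>
definition occ :: "nat \<Rightarrow> (nat \<Rightarrow> 'a) \<Rightarrow> 'a \<Rightarrow> real" where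
  "occ k x a = (\<Sum>i=1..k. of_bool (x i = a))"

lemma occ_nonneg: "0 \<le> occ k x a"
  unfolding occ_def by (intro sum_nonneg) auto

lemma occ_permute:
  assumes "\<sigma> permutes {1..n}"
  shows "occ n (\<lambda>i. y (\<sigma> i)) a = occ n y a"
  unfolding occ_def using sum.permute[OF assms, of "\<lambda>i. of_bool (y i = a)"]
  unfolding o_def by (rule sym)

lemma sum_occ:
  assumes "finite A" "x ` {1..k} \<subseteq> A"
  shows "(\<Sum>a\<in>A. occ k x a * g a) = (\<Sum>i=1..k. g (x i))"
proof -
  have "(\<Sum>a\<in>A. occ k x a * g a) = (\<Sum>i=1..k. \<Sum>a\<in>A. of_bool (x i = a) * g a)"
    unfolding occ_def sum_distrib_right by (rule sum.swap)
  also have "\<dots> = (\<Sum>i=1..k. g (x i))"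
  proof (rule sum.cong[OF refl])
    fix i assume "i \<in> {1..k}"
    then have "x i \<in> A" using assms(2) by auto
    moreover have "(\<Sum>a\<in>A. of_bool (x i = a) * g a) = (\<Sum>a\<in>A. if x i = a then g a else 0)"
      by (intro sum.cong) auto
    ultimately show "(\<Sum>a\<in>A. of_bool (x i = a) * g a) = g (x i)" using assms(1) by simp
  qed
  finally show ?thesis .
qed

lemma sum_tail:
  fixes g :: "nat \<Rightarrow> real"
  assumes "k \<le> n"
  shows "(\<Sum>m=Suc k..n. g m) = (\<Sum>m=1..n. g m) - (\<Sum>m=1..k. g m)"
proof -
  have "{1..n} = {1..k} \<union> {Suc k..n}" using assms by auto
  then show ?thesis by (simp add: sum.union_disjoint)
qed

text \<open>
  The urn contains the balls \<open>1, \<dots>, n\<close>, and ball \<open>i\<close> has colour \<open>y i\<close>. Drawing all balls in a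
  uniformly random order \<open>\<sigma>\<close> gives the colour sequence \<open>\<lambda>i. y (\<sigma> i)\<close>.
\<close>
locale urn =
  fixes n :: nat and y :: "nat \<Rightarrow> 'a"
  assumes n: "1 \<le> n"
begin

definition colours :: "'a set" where "colours = y ` {1..n}"

definition freq :: "'a \<Rightarrow> real" where "freq a = occ n y a / real n"

text \<open>
  The probabilities that the first \<open>k\<close> draws show the colours \<open>z 1, \<dots>, z k\<close>, without replacement
  (\<open>urn_mass\<close>) and with replacement (\<open>iid_mass\<close>).
\<close>
definition urn_mass :: "nat \<Rightarrow> (nat \<Rightarrow> 'a) \<Rightarrow> real" where
  "urn_mass k z = perm_avg n (\<lambda>\<sigma>. of_bool (\<forall>i\<in>{1..k}. y (\<sigma> i) = z i))"

definition iid_mass :: "nat \<Rightarrow> (nat \<Rightarrow> 'a) \<Rightarrow> real" where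
  "iid_mass k z = (\<Prod>i=1..k. freq (z i))"

definition excess :: "nat \<Rightarrow> (nat \<Rightarrow> nat) \<Rightarrow> 'a \<Rightarrow> real" where
  "excess k \<sigma> a = occ k (\<lambda>i. y (\<sigma> i)) a - real k * freq a"

text \<open>
  The relative entropy of the first \<open>k\<close> draws without replacement with respect to \<open>k\<close> draws with
  replacement. As an average over permutations, the logarithm is only evaluated at sequences of
  positive probability.
\<close>
definition rel_entropy :: "nat \<Rightarrow> real" where
  "rel_entropy k = perm_avg n (\<lambda>\<sigma>. ln (urn_mass k (\<lambda>i. y (\<sigma> i)) / iid_mass k (\<lambda>i. y (\<sigma> i))))"

lemma finite_colours: "finite colours"
  by (simp add: colours_def)

lemma freq_nonneg: "0 \<le> freq a"
  by (simp add: freq_def occ_nonneg)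

lemma freq_pos: "a \<in> colours \<Longrightarrow> 0 < freq a"
proof -
  assume "a \<in> colours"
  then obtain i where "i \<in> {1..n}" "y i = a" by (auto simp: colours_def)
  then have "0 < occ n y a" unfolding occ_def by (intro sum_pos2[of _ i]) auto
  then show ?thesis using n by (simp add: freq_def)
qed

lemma sum_freq:
  assumes "finite A" "y ` {1..n} \<subseteq> A"
  shows "(\<Sum>a\<in>A. freq a) = 1"
  using sum_occ[OF assms, of "\<lambda>_. 1"] n by (simp add: freq_def flip: sum_divide_distrib)

lemma colour_perm:
  "\<sigma> permutes {1..n} \<Longrightarrow> i \<in> {1..n} \<Longrightarrow> y (\<sigma> i) \<in> colours"
  using permutes_in_image[of \<sigma> "{1..n}" i] by (auto simp: colours_def)

lemma excess_variance:
  assumes "k \<le> n"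
  shows "perm_avg n (\<lambda>\<sigma>. (excess k \<sigma> a)\<^sup>2) \<le> real k * (freq a * (1 - freq a))"
proof -
  define h where "h i = of_bool (y i = a) - freq a" for i
  have s: "(\<Sum>i=1..n. of_bool (y i = a)) = real n * freq a"
    using n by (simp add: freq_def occ_def)
  have h0: "(\<Sum>i=1..n. h i) = 0" unfolding h_def sum_subtractf s by simp
  have "(h i)\<^sup>2 = (1 - 2 * freq a) * of_bool (y i = a) + (freq a)\<^sup>2" for i
    by (simp add: h_def power2_eq_square algebra_simps)
  then have "(\<Sum>i=1..n. (h i)\<^sup>2) = (1 - 2 * freq a) * (real n * freq a) + real n * (freq a)\<^sup>2"
    by (simp only: sum.distrib sum_distrib_left[symmetric] s) simp
  then have h2: "(\<Sum>i=1..n. (h i)\<^sup>2) = real n * (freq a * (1 - freq a))"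
    by (simp add: algebra_simps power2_eq_square)
  have ex: "excess k \<sigma> a = (\<Sum>i=1..k. h (\<sigma> i))" for \<sigma>
    by (simp add: excess_def occ_def h_def sum_subtractf)
  show ?thesis using perm_avg_square_sum_le[OF assms h0] n unfolding ex h2 by simp
qed

text \<open>
  Given the first \<open>k\<close> colours, the next ball is uniform among the \<open>n - k\<close> remaining ones; the number of
  these that have a given colour is the total number minus the number already drawn.
\<close>
lemma urn_mass_Suc:
  assumes "k < n"
  shows "real (n - k) * urn_mass (Suc k) z
    = urn_mass k z * (occ n y (z (Suc k)) - occ k z (z (Suc k)))"
proof -
  define f where "f \<sigma> m = (of_bool (\<forall>i\<in>{1..k}. y (\<sigma> i) = z i) * of_bool (y m = z (Suc k)) :: real)"
    for \<sigma> :: "nat \<Rightarrow> nat" and m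
  have um: "urn_mass (Suc k) z = perm_avg n (\<lambda>\<sigma>. f \<sigma> (\<sigma> (Suc k)))"
    unfolding urn_mass_def f_def by (intro perm_avg_cong) (auto simp: atLeastAtMostSuc_conv)
  have fc: "f \<sigma> m = f \<sigma>' m" if "\<And>i. i \<in> {1..k} \<Longrightarrow> \<sigma> i = \<sigma>' i" for \<sigma> \<sigma>' m
  proof -
    have "(\<forall>i\<in>{1..k}. y (\<sigma> i) = z i) \<longleftrightarrow> (\<forall>i\<in>{1..k}. y (\<sigma>' i) = z i)"
      by (intro ball_cong refl) (simp only: that)
    then show ?thesis by (simp only: f_def)
  qed
  have "real (n - k) * urn_mass (Suc k) z = perm_avg n (\<lambda>\<sigma>. \<Sum>m=Suc k..n. f \<sigma> (\<sigma> m))"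
    unfolding um by (rule perm_avg_next_position[where f = f, OF assms]) (rule fc, simp)
  also have "\<dots> = perm_avg n (\<lambda>\<sigma>. (occ n y (z (Suc k)) - occ k z (z (Suc k)))
      * of_bool (\<forall>i\<in>{1..k}. y (\<sigma> i) = z i))"
  proof (rule perm_avg_cong)
    fix \<sigma> assume s: "\<sigma> permutes {1..n}"
    have "(\<Sum>m=Suc k..n. of_bool (y (\<sigma> m) = z (Suc k)) :: real) 
        = occ n (\<lambda>i. y (\<sigma> i)) (z (Suc k)) - occ k (\<lambda>i. y (\<sigma> i)) (z (Suc k))"
      unfolding occ_def using assms by (intro sum_tail) simp
    moreover have "occ k (\<lambda>i. y (\<sigma> i)) (z (Suc k)) = occ k z (z (Suc k))" if "\<forall>i\<in>{1..k}. y (\<sigma> i) = z i"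
      unfolding occ_def using that by (intro sum.cong) auto
    ultimately show "(\<Sum>m=Suc k..n. f \<sigma> (\<sigma> m)) = (occ n y (z (Suc k)) - occ k z (z (Suc k)))
      * of_bool (\<forall>i\<in>{1..k}. y (\<sigma> i) = z i)"
      unfolding f_def occ_permute[OF s, of y] by (cases "\<forall>i\<in>{1..k}. y (\<sigma> i) = z i") simp_all
  qed
  finally show ?thesis by (simp add: perm_avg_cmult urn_mass_def)
qed

lemma urn_mass_nonneg: "0 \<le> urn_mass k z"
  unfolding urn_mass_def by (intro perm_avg_nonneg) auto

lemma urn_mass_pos: "\<sigma> permutes {1..n} \<Longrightarrow> 0 < urn_mass k (\<lambda>i. y (\<sigma> i))"
  unfolding urn_mass_def by (rule perm_avg_pos[where ?\<sigma>0.0 = \<sigma>]) auto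

lemma iid_mass_nonneg: "0 \<le> iid_mass k z"
  unfolding iid_mass_def by (intro prod_nonneg) (simp add: freq_nonneg)

lemma iid_mass_pos: "\<sigma> permutes {1..n} \<Longrightarrow> k \<le> n \<Longrightarrow> 0 < iid_mass k (\<lambda>i. y (\<sigma> i))"
  unfolding iid_mass_def by (intro prod_pos ballI freq_pos colour_perm) auto

text \<open>
  One factor of the likelihood ratio is \<open>q / freq a\<close>, with \<open>q\<close> the conditional probability
  that the next colour is \<open>a\<close>. Here \<open>q\<close> falls short of \<open>freq a\<close> by the excess with which \<open>a\<close> has been drawn,
  spread over the \<open>n - k\<close> remaining balls; \<open>ln t \<le> t - 1\<close> then makes the bound linear in the excess.
\<close>
lemma log_ratio_Suc:
  assumes s: "\<sigma> permutes {1..n}" and k: "k < n"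
  defines "x \<equiv> \<lambda>i. y (\<sigma> i)"
  shows "ln (urn_mass (Suc k) x / iid_mass (Suc k) x)
      \<le> ln (urn_mass k x / iid_mass k x) - excess k \<sigma> (x (Suc k)) / freq (x (Suc k)) / real (n - k)"
proof -
  define a where "a = x (Suc k)"
  define e where "e = excess k \<sigma> a / freq a / real (n - k)"
  define q where "q = (occ n y a - occ k x a) / real (n - k)"
  have u: "urn_mass (Suc k) x = urn_mass k x * q"
    using urn_mass_Suc[OF k, of x] k unfolding q_def a_def by (simp add: field_simps)
  have i: "iid_mass (Suc k) x = iid_mass k x * freq a" by (simp add: iid_mass_def a_def)
  have up: "0 < urn_mass k x" "0 < urn_mass (Suc k) x" "0 < iid_mass k x"
    using urn_mass_pos[OF s] iid_mass_pos[OF s, of k] k by (simp_all add: x_def)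
  then have q: "0 < q" unfolding u by (simp add: zero_less_mult_iff)
  have f: "0 < freq a" unfolding a_def x_def using k by (intro freq_pos colour_perm[OF s]) auto
  have "q = freq a - excess k \<sigma> a / real (n - k)"
    unfolding q_def excess_def x_def using n k by (simp add: freq_def field_simps of_nat_diff)
  then have "q / freq a - 1 = - e"
    using f by (simp add: e_def diff_divide_distrib)
  moreover have "ln (q / freq a) \<le> q / freq a - 1" using q f by (intro ln_le_minus_one) auto
  ultimately have le: "ln (q / freq a) \<le> - e" by simp
  have "urn_mass (Suc k) x / iid_mass (Suc k) x = (urn_mass k x / iid_mass k x) * (q / freq a)"
    by (simp only: u i times_divide_times_eq)
  also have "ln \<dots> = ln (urn_mass k x / iid_mass k x) + ln (q / freq a)"
    using q f up by (intro ln_mult_pos) auto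
  also have "\<dots> \<le> ln (urn_mass k x / iid_mass k x) - e" using le by simp
  finally show ?thesis by (simp only: a_def e_def)
qed

text \<open>
  A colour drawn too often so far is less likely to come next. Averaging over the tail turns the
  linear correction of the log ratio into the chi-square distance of the conditional law of the next
  colour; the first-order terms cancel since the excesses of all colours add up to \<open>0\<close>.
\<close>
lemma avg_excess_next:
  assumes k: "k < n"
  shows "real (n - k) * perm_avg n (\<lambda>\<sigma>. excess k \<sigma> (y (\<sigma> (Suc k))) / freq (y (\<sigma> (Suc k))))
    = - (\<Sum>a\<in>colours. perm_avg n (\<lambda>\<sigma>. (excess k \<sigma> a)\<^sup>2) / freq a)"
proof -
  have cong: "excess k \<sigma> = excess k \<sigma>'" if "\<And>i. i \<in> {1..k} \<Longrightarrow> \<sigma> i = \<sigma>' i" for \<sigma> \<sigma>'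
    unfolding excess_def occ_def by (intro ext arg_cong2[where f="(-)"] sum.cong refl) (simp only: that)
  have "real (n - k) * perm_avg n (\<lambda>\<sigma>. excess k \<sigma> (y (\<sigma> (Suc k))) / freq (y (\<sigma> (Suc k))))
    = perm_avg n (\<lambda>\<sigma>. \<Sum>m=Suc k..n. excess k \<sigma> (y (\<sigma> m)) / freq (y (\<sigma> m)))"
    by (rule perm_avg_next_position[OF k, of "\<lambda>\<sigma> m. excess k \<sigma> (y m) / freq (y m)"])
      (rule arg_cong2[where f="(/)"], rule fun_cong[OF cong], simp_all)
  also have "\<dots> = perm_avg n (\<lambda>\<sigma>. \<Sum>a\<in>colours. - 1 / freq a * (excess k \<sigma> a)\<^sup>2)"
  proof (rule perm_avg_cong)
    fix \<sigma> assume s: "\<sigma> permutes {1..n}"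
    let ?x = "\<lambda>i. y (\<sigma> i)" and ?e = "excess k \<sigma>"
    have im: "?x ` {1..n} \<subseteq> colours" "?x ` {1..k} \<subseteq> colours" "y ` {1..n} \<subseteq> colours"
    proof -
      show "?x ` {1..n} \<subseteq> colours" by (intro image_subsetI colour_perm[OF s])
      show "?x ` {1..k} \<subseteq> colours" using k by (intro image_subsetI colour_perm[OF s]) simp
    qed (simp add: colours_def)
    have "(\<Sum>m=Suc k..n. ?e (?x m) / freq (?x m))
       = (\<Sum>m=1..n. ?e (?x m) / freq (?x m)) - (\<Sum>m=1..k. ?e (?x m) / freq (?x m))"
      using k by (intro sum_tail) simp
    also have "\<dots> = (\<Sum>a\<in>colours. occ n ?x a * (?e a / freq a)) - (\<Sum>a\<in>colours. occ k ?x a * (?e a / freq a))"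
      unfolding sum_occ[OF finite_colours im(1)] sum_occ[OF finite_colours im(2)] by (rule refl)
    also have "\<dots> = (\<Sum>a\<in>colours. (occ n y a - occ k ?x a) * (?e a / freq a))"
      unfolding occ_permute[OF s, of y] left_diff_distrib sum_subtractf by (rule refl)
    also have "\<dots> = (\<Sum>a\<in>colours. real (n - k) * ?e a + - 1 / freq a * (?e a)\<^sup>2)"
    proof (rule sum.cong[OF refl])
      fix a assume "a \<in> colours"
      then have f: "0 < freq a" by (rule freq_pos)
      have E: "occ n y a - occ k ?x a = real (n - k) * freq a - ?e a"
        using n k by (simp add: excess_def freq_def of_nat_diff field_simps)
      show "(occ n y a - occ k ?x a) * (?e a / freq a) = real (n - k) * ?e a + - 1 / freq a * (?e a)\<^sup>2"
        unfolding E using f by (simp add: field_simps power2_eq_square)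
    qed
    also have "\<dots> = real (n - k) * (\<Sum>a\<in>colours. ?e a) + (\<Sum>a\<in>colours. - 1 / freq a * (?e a)\<^sup>2)"
      by (simp only: sum.distrib sum_distrib_left)
    also have "(\<Sum>a\<in>colours. ?e a) = 0"
      using sum_occ[OF finite_colours im(2), of "\<lambda>_. 1"] sum_freq[OF finite_colours im(3)]
      by (simp add: excess_def sum_subtractf flip: sum_distrib_left)
    finally show "(\<Sum>m=Suc k..n. ?e (?x m) / freq (?x m)) = (\<Sum>a\<in>colours. - 1 / freq a * (?e a)\<^sup>2)"
      by simp
  qed
  also have "\<dots> = - (\<Sum>a\<in>colours. perm_avg n (\<lambda>\<sigma>. (excess k \<sigma> a)\<^sup>2) / freq a)"
    by (simp only: perm_avg_sum perm_avg_cmult) (simp add: sum_negf)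
  finally show ?thesis .
qed

text \<open>
  The chain rule for relative entropy, in which the contribution of a step is bounded by its expected chi-square
  distance. The variance bound for the excess makes colour \<open>a\<close> contribute at most
  \<open>real k * (1 - freq a)\<close>, and \<open>1 - freq a\<close> sums to the number of colours minus \<open>1\<close>.
\<close>
lemma rel_entropy_Suc:
  assumes k: "k < n"
  shows "rel_entropy (Suc k) \<le> rel_entropy k + (real (card colours) - 1) * (real k / (real (n - k))\<^sup>2)"
proof -
  define E where "E = perm_avg n (\<lambda>\<sigma>. excess k \<sigma> (y (\<sigma> (Suc k))) / freq (y (\<sigma> (Suc k))))"
  define V where "V = (\<Sum>a\<in>colours. perm_avg n (\<lambda>\<sigma>. (excess k \<sigma> a)\<^sup>2) / freq a)"
  have nk: "0 < real (n - k)" using k by simp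
  have "rel_entropy (Suc k) \<le> perm_avg n (\<lambda>\<sigma>. ln (urn_mass k (\<lambda>i. y (\<sigma> i)) / iid_mass k (\<lambda>i. y (\<sigma> i)))
      + (- 1 / real (n - k)) * (excess k \<sigma> (y (\<sigma> (Suc k))) / freq (y (\<sigma> (Suc k)))))"
    unfolding rel_entropy_def using log_ratio_Suc[OF _ k] by (intro perm_avg_mono) (simp add: mult.commute)
  also have "\<dots> = rel_entropy k - E / real (n - k)"
    unfolding rel_entropy_def E_def perm_avg_add perm_avg_cmult by simp
  also have "E = - V / real (n - k)"
    using avg_excess_next[OF k] nk unfolding E_def V_def by (simp add: field_simps)
  also have "rel_entropy k - - V / real (n - k) / real (n - k) = rel_entropy k + V / (real (n - k))\<^sup>2"
    by (simp add: power2_eq_square)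
  also have "V \<le> (\<Sum>a\<in>colours. real k * (1 - freq a))"
    unfolding V_def
  proof (rule sum_mono)
    fix a assume "a \<in> colours"
    then have f: "0 < freq a" by (rule freq_pos)
    have "perm_avg n (\<lambda>\<sigma>. (excess k \<sigma> a)\<^sup>2) \<le> real k * (freq a * (1 - freq a))"
      using k by (intro excess_variance) simp
    then show "perm_avg n (\<lambda>\<sigma>. (excess k \<sigma> a)\<^sup>2) / freq a \<le> real k * (1 - freq a)"
      using f by (simp add: field_simps)
  qed
  also have "\<dots> = (real (card colours) - 1) * real k"
    using sum_freq[OF finite_colours] by (simp add: sum_subtractf colours_def flip: sum_distrib_left)
  finally show ?thesis using nk by (simp add: divide_right_mono)
qed

lemma rel_entropy_le: "k \<le> n \<Longrightarrow> rel_entropy k \<le> (real (card colours) - 1) * (\<Sum>i<k. real i / (real (n - i))\<^sup>2)"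
proof (induction k)
  case 0
  then show ?case by (simp add: rel_entropy_def urn_mass_def iid_mass_def)
next
  case (Suc k)
  then show ?case using rel_entropy_Suc[of k] by (simp add: algebra_simps)
qed

text \<open>
  Grouping the permutations by the first \<open>k\<close> colours they produce.
\<close>
lemma avg_prefix:
  assumes X: "finite X" "y \<in> {1..n} \<rightarrow> X" and k: "k \<le> n"
  shows "perm_avg n (\<lambda>\<sigma>. F (restrict (\<lambda>i. y (\<sigma> i)) {1..k})) = (\<Sum>z\<in>PiE {1..k} (\<lambda>_. X). urn_mass k z * F z)"
proof -
  let ?T = "PiE {1..k} (\<lambda>_. X)"
  have fT: "finite ?T" using X by (intro finite_PiE) auto
  have "perm_avg n (\<lambda>\<sigma>. F (restrict (\<lambda>i. y (\<sigma> i)) {1..k}))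
     = perm_avg n (\<lambda>\<sigma>. \<Sum>z\<in>?T. F z * of_bool (\<forall>i\<in>{1..k}. y (\<sigma> i) = z i))"
  proof (rule perm_avg_cong)
    fix \<sigma> assume s: "\<sigma> permutes {1..n}"
    let ?z = "restrict (\<lambda>i. y (\<sigma> i)) {1..k}"
    have z: "?z \<in> ?T" using colour_perm[OF s] X(2) k by (fastforce simp: colours_def)
    have "(\<forall>i\<in>{1..k}. y (\<sigma> i) = z i) \<longleftrightarrow> ?z = z" if "z \<in> ?T" for z
    proof
      assume "\<forall>i\<in>{1..k}. y (\<sigma> i) = z i"
      with z that show "?z = z" by (intro PiE_ext[OF z that]) auto
    qed auto
    then have "(\<Sum>z\<in>?T. F z * of_bool (\<forall>i\<in>{1..k}. y (\<sigma> i) = z i)) = (\<Sum>z\<in>?T. if ?z = z then F z else 0)"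
      by (intro sum.cong) auto
    then show "F ?z = (\<Sum>z\<in>?T. F z * of_bool (\<forall>i\<in>{1..k}. y (\<sigma> i) = z i))"
      using z fT by simp
  qed
  also have "\<dots> = (\<Sum>z\<in>?T. urn_mass k z * F z)"
    by (simp add: perm_avg_sum perm_avg_cmult urn_mass_def mult.commute)
  finally show ?thesis .
qed

lemma sum_urn_mass:
  assumes "finite X" "y \<in> {1..n} \<rightarrow> X" "k \<le> n"
  shows "(\<Sum>z\<in>PiE {1..k} (\<lambda>_. X). urn_mass k z) = 1"
  using avg_prefix[OF assms, of "\<lambda>_. 1"] by simp

lemma sum_iid_mass:
  assumes "finite X" "y \<in> {1..n} \<rightarrow> X"
  shows "(\<Sum>z\<in>PiE {1..k} (\<lambda>_. X). iid_mass k z) = 1"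
proof -
  have "(\<Prod>i\<in>{1..k}. \<Sum>a\<in>X. freq a) = (\<Sum>z\<in>PiE {1..k} (\<lambda>_. X). iid_mass k z)"
    unfolding iid_mass_def using assms by (intro prod_sum_PiE) auto
  moreover have "(\<Sum>a\<in>X. freq a) = 1" using assms by (intro sum_freq) auto
  ultimately show ?thesis by simp
qed

lemma urn_mass_cong: "(\<And>i. i \<in> {1..k} \<Longrightarrow> z i = z' i) \<Longrightarrow> urn_mass k z = urn_mass k z'"
  unfolding urn_mass_def by (intro perm_avg_cong arg_cong[where f=of_bool] ball_cong) auto

lemma iid_mass_cong: "(\<And>i. i \<in> {1..k} \<Longrightarrow> z i = z' i) \<Longrightarrow> iid_mass k z = iid_mass k z'"
  unfolding iid_mass_def by (intro prod.cong) auto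

lemma event_diff_sq_le_rel_entropy:
  assumes X: "finite X" "y \<in> {1..n} \<rightarrow> X" and k: "k \<le> n" and A: "A \<subseteq> PiE {1..k} (\<lambda>_. X)"
  shows "(sum (urn_mass k) A - sum (iid_mass k) A)\<^sup>2 \<le> rel_entropy k"
proof -
  let ?T = "PiE {1..k} (\<lambda>_. X)"
  have "rel_entropy k = perm_avg n (\<lambda>\<sigma>. (\<lambda>z. ln (urn_mass k z / iid_mass k z)) (restrict (\<lambda>i. y (\<sigma> i)) {1..k}))"
    unfolding rel_entropy_def by (intro perm_avg_cong arg_cong[where f=ln] arg_cong2[where f="(/)"] urn_mass_cong iid_mass_cong) auto
  also have "\<dots> = (\<Sum>z\<in>?T. urn_mass k z * ln (urn_mass k z / iid_mass k z))"
    by (rule avg_prefix[OF X k])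
  finally have rel_entropy: "rel_entropy k = (\<Sum>z\<in>?T. urn_mass k z * ln (urn_mass k z / iid_mass k z))" .
  have ac: "0 < iid_mass k z" if "0 < urn_mass k z" for z
  proof (rule ccontr)
    assume no: "\<not> 0 < iid_mass k z"
    have "\<not> (\<forall>i\<in>{1..k}. y (\<sigma> i) = z i)" if "\<sigma> permutes {1..n}" for \<sigma>
    proof
      assume "\<forall>i\<in>{1..k}. y (\<sigma> i) = z i"
      then have "iid_mass k (\<lambda>i. y (\<sigma> i)) = iid_mass k z" by (intro iid_mass_cong) blast
      with iid_mass_pos[OF that k] no show False by simp
    qed
    then have "urn_mass k z = perm_avg n (\<lambda>_. 0)" unfolding urn_mass_def by (intro perm_avg_cong) auto
    with \<open>0 < urn_mass k z\<close> show False by simp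
  qed
  show ?thesis unfolding rel_entropy
    using X by (intro event_diff_sq_le_relative_entropy A finite_PiE urn_mass_nonneg iid_mass_nonneg sum_urn_mass sum_iid_mass k ac) auto
qed

text \<open>
  For \<open>n \<le> card X * k\<close> the right-hand side is at least \<open>1\<close>. Otherwise either there is a single colour,
  and the relative entropy vanishes, or \<open>2 * k \<le> n\<close>; then every \<open>n - i\<close> with \<open>i < k\<close> is at least
  \<open>n / 2\<close>, and the relative entropy is at most \<open>2 * (c - 1) * (k / n)\<^sup>2\<close>, which is at most
  \<open>(c * k / n)\<^sup>2\<close> for \<open>c\<close> colours.
\<close>
theorem sampling_without_replacement_vs_iid:
  assumes X: "finite X" "y \<in> {1..n} \<rightarrow> X" and k: "k \<le> n" and A: "A \<subseteq> PiE {1..k} (\<lambda>_. X)"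
  shows "\<bar>sum (urn_mass k) A - sum (iid_mass k) A\<bar> \<le> real (card X) * real k / real n"
proof (cases "n \<le> card X * k")
  case True
  have "finite (PiE {1..k} (\<lambda>_. X))" using X by (intro finite_PiE) auto
  then have "sum (urn_mass k) A \<le> 1" "sum (iid_mass k) A \<le> 1"
    using sum_mono2[OF _ A, of "urn_mass k"] sum_mono2[OF _ A, of "iid_mass k"]
      sum_urn_mass[OF X k] sum_iid_mass[OF X, of k] urn_mass_nonneg iid_mass_nonneg by auto
  moreover have "0 \<le> sum (urn_mass k) A" "0 \<le> sum (iid_mass k) A"
    by (simp_all add: sum_nonneg urn_mass_nonneg iid_mass_nonneg)
  ultimately have "\<bar>sum (urn_mass k) A - sum (iid_mass k) A\<bar> \<le> 1" by linarith
  also have "1 \<le> real (card X * k) / real n" using n True by (simp add: field_simps flip: of_nat_mult)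
  finally show ?thesis by simp
next
  case False
  define c where "c = real (card colours)"
  have "card colours \<le> card X" using X by (intro card_mono) (auto simp: colours_def)
  then have cX: "c \<le> real (card X)" by (simp add: c_def)
  have "card colours \<ge> 1" using n by (simp add: colours_def Suc_le_eq card_gt_0_iff)
  then have c1: "1 \<le> c" by (simp add: c_def)
  have D: "(sum (urn_mass k) A - sum (iid_mass k) A)\<^sup>2 \<le> (c - 1) * (\<Sum>i<k. real i / (real (n - i))\<^sup>2)"
    using event_diff_sq_le_rel_entropy[OF X k A] rel_entropy_le[OF k] unfolding c_def by linarith
  have "(c - 1) * (\<Sum>i<k. real i / (real (n - i))\<^sup>2) \<le> (real (card X) * real k / real n)\<^sup>2"
  proof (cases "c = 1")
    case c2: False
    then have "2 \<le> card X" using c1 cX by (simp add: c_def)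
    then have "2 * k \<le> card X * k" by (rule mult_right_mono) simp
    then have kn: "2 * k \<le> n" using False by linarith
    have "(\<Sum>i<k. real i / (real (n - i))\<^sup>2) \<le> (\<Sum>i<k. 4 / (real n)\<^sup>2 * real i)"
    proof (rule sum_mono)
      fix i assume "i \<in> {..<k}"
      then have h: "real n / 2 \<le> real (n - i)" using kn by (simp add: of_nat_diff)
      have "real i / (real (n - i))\<^sup>2 \<le> real i / (real n / 2)\<^sup>2"
        using h n by (intro divide_left_mono power_mono) auto
      then show "real i / (real (n - i))\<^sup>2 \<le> 4 / (real n)\<^sup>2 * real i" by (simp add: power_divide mult.commute)
    qed
    also have "\<dots> = 4 / (real n)\<^sup>2 * (\<Sum>i<k. real i)" by (simp only: sum_distrib_left)
    also have "\<dots> \<le> 4 / (real n)\<^sup>2 * ((real k)\<^sup>2 / 2)"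
    proof (rule mult_left_mono)
      show "(\<Sum>i<k. real i) \<le> (real k)\<^sup>2 / 2"
        by (induction k) (auto simp: power2_eq_square algebra_simps)
    qed simp
    finally have S: "(\<Sum>i<k. real i / (real (n - i))\<^sup>2) \<le> 2 * (real k / real n)\<^sup>2"
      by (simp add: power_divide)
    have "(c - 1) * (\<Sum>i<k. real i / (real (n - i))\<^sup>2) \<le> (c - 1) * (2 * (real k / real n)\<^sup>2)"
      using S c1 by (intro mult_left_mono) auto
    also have "\<dots> = (2 * (c - 1)) * (real k / real n)\<^sup>2" by simp
    also have "\<dots> \<le> (real (card X))\<^sup>2 * (real k / real n)\<^sup>2"
    proof (rule mult_right_mono)
      have "2 * (c - 1) \<le> c\<^sup>2" using zero_le_power2[of "c - 1"] by (simp add: power2_eq_square algebra_simps)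
      also have "\<dots> \<le> (real (card X))\<^sup>2" using c1 cX by (intro power_mono) auto
      finally show "2 * (c - 1) \<le> (real (card X))\<^sup>2" .
    qed simp
    finally show ?thesis by (simp add: power_mult_distrib power_divide)
  qed simp
  with D have "\<bar>sum (urn_mass k) A - sum (iid_mass k) A\<bar>\<^sup>2 \<le> (real (card X) * real k / real n)\<^sup>2" by simp
  then show ?thesis by (rule power2_le_imp_le) simp
qed

end

section \<open>Weighted sampling\<close>
lemma prod_split:
  fixes g :: "nat \<Rightarrow> real"
  assumes "k \<le> n"
  shows "(\<Prod>i=1..n. g i) = (\<Prod>i=1..k. g i) * (\<Prod>i=k+1..n. g i)"
proof -
  have "{1..n} = {1..k} \<union> {k+1..n}" using assms by auto
  then show ?thesis by (simp add: prod.union_disjoint)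
qed

lemma weight_bounds:
  assumes "finite X" "x \<in> X" "\<And>x. x \<in> X \<Longrightarrow> 0 < w x"
  shows "Min (w ` X) \<le> w x" "w x \<le> Max (w ` X)" "0 < Min (w ` X)" "0 < Max (w ` X)"
    "0 < weight_ratio X w" "weight_ratio X w \<le> 1"
proof -
  have ne: "w ` X \<noteq> {}" "finite (w ` X)" using assms by auto
  show 1: "Min (w ` X) \<le> w x" "w x \<le> Max (w ` X)" using assms by auto
  show 2: "0 < Min (w ` X)" using ne assms(3) by (subst Min_gr_iff) auto
  then show 3: "0 < Max (w ` X)" using 1 by linarith
  show "0 < weight_ratio X w" "weight_ratio X w \<le> 1" using 1 2 3 by (auto simp: weight_ratio_def)
qed

lemma weight_prod_bounds:
  fixes l :: "nat \<Rightarrow> 'a \<Rightarrow> real"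
  assumes X: "finite X" "X \<noteq> {}" and l: "weight_seq n X l" and I: "I \<subseteq> {1..n}"
  defines "m \<equiv> \<Prod>i\<in>I. Min (l i ` X)" and "M \<equiv> \<Prod>i\<in>I. Max (l i ` X)" and "R \<equiv> \<Prod>i\<in>I. weight_ratio X (l i)"
  shows "0 < m" "0 < R" "R \<le> 1" "M = m / R"
    "\<And>z. z \<in> I \<rightarrow> X \<Longrightarrow> m \<le> (\<Prod>i\<in>I. l i (z i))" "\<And>z. z \<in> I \<rightarrow> X \<Longrightarrow> (\<Prod>i\<in>I. l i (z i)) \<le> M"
proof -
  obtain x0 where x0: "x0 \<in> X" using X by auto
  have p: "0 < l i x" if "i \<in> I" "x \<in> X" for i x using l I that by (auto simp: weight_seq_def)
  have b: "Min (l i ` X) \<le> l i x" "l i x \<le> Max (l i ` X)" "0 < Min (l i ` X)" "0 < Max (l i ` X)"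
    "0 < weight_ratio X (l i)" "weight_ratio X (l i) \<le> 1" if "i \<in> I" "x \<in> X" for i x
    using weight_bounds[OF X(1) that(2), of "l i"] p[OF that(1)] by blast+
  show m: "0 < m" unfolding m_def by (intro prod_pos ballI b(3)[OF _ x0])
  show R: "0 < R" unfolding R_def by (intro prod_pos ballI b(5)[OF _ x0])
  show "R \<le> 1" unfolding R_def using b(5,6)[OF _ x0] by (intro prod_le_1) (auto intro: less_imp_le)
  have "0 < M" unfolding M_def by (intro prod_pos ballI b(4)[OF _ x0])
  then show "M = m / R" using m unfolding R_def weight_ratio_def prod_dividef m_def M_def by simp
  show "m \<le> (\<Prod>i\<in>I. l i (z i))" if "z \<in> I \<rightarrow> X" for z
    unfolding m_def using that b(1) b(3)[OF _ x0] by (intro prod_mono) (auto simp: Pi_iff intro: less_imp_le)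
  show "(\<Prod>i\<in>I. l i (z i)) \<le> M" if "z \<in> I \<rightarrow> X" for z
    unfolding M_def using that b(2) p by (intro prod_mono) (auto simp: Pi_iff intro: less_imp_le)
qed

lemma perm_avg_of_bool:
  "perm_avg n (\<lambda>\<sigma>. f \<sigma> * of_bool (Q \<sigma>)) = sum f {\<sigma>. \<sigma> permutes {1..n} \<and> Q \<sigma>} / fact n"
proof -
  have "sum f {\<sigma> \<in> {\<sigma>. \<sigma> permutes {1..n}}. Q \<sigma>} = (\<Sum>\<sigma> | \<sigma> permutes {1..n}. if Q \<sigma> then f \<sigma> else 0)"
    by (rule sum.inter_filter) (simp add: finite_permutations)
  also have "\<dots> = (\<Sum>\<sigma> | \<sigma> permutes {1..n}. f \<sigma> * of_bool (Q \<sigma>))" by (intro sum.cong) auto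
  finally show ?thesis unfolding perm_avg_def by simp
qed

context urn
begin

text \<open>
  The weight of a colour sequence is \<open>v\<close>, from the first \<open>k\<close> positions, times a tail factor from the others.
  Dropping the tail factor is a change of measure on permutations by a function whose ratio of
  maximum to minimum is at most \<open>s\<^sup>2\<close>, which costs \<open>(s - 1) / (s + 1)\<close>. What is left depends on the first
  \<open>k\<close> colours only, and both sampling schemes are then reweighted by the same \<open>v\<close>; this multiplies
  their distance by at most \<open>1 / R\<close>.
\<close>
theorem weighted_urn_vs_weighted_iid:
  fixes l :: "nat \<Rightarrow> 'a \<Rightarrow> real"
  assumes X: "finite X" "y \<in> {1..n} \<rightarrow> X" and k: "k \<le> n" and B: "B \<subseteq> PiE {1..k} (\<lambda>_. X)"
    and l: "weight_seq n X l"
  defines "w \<equiv> \<lambda>x. \<Prod>i=1..n. l i (x i)" and "v \<equiv> \<lambda>x. \<Prod>i=1..k. l i (x i)"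
    and "R \<equiv> \<Prod>i=1..k. weight_ratio X (l i)" and "s \<equiv> (\<Prod>i=k+1..n. weight_ratio X (l i)) powr (- 1/2)"
  shows "\<bar>perm_avg n (\<lambda>\<sigma>. w (\<lambda>i. y (\<sigma> i)) * of_bool (restrict (\<lambda>i. y (\<sigma> i)) {1..k} \<in> B)) / perm_avg n (\<lambda>\<sigma>. w (\<lambda>i. y (\<sigma> i)))
      - (\<Sum>z\<in>B. v z * iid_mass k z) / (\<Sum>z\<in>PiE {1..k} (\<lambda>_. X). v z * iid_mass k z)\<bar>
    \<le> real (card X) * real k / real n / R + (s - 1) / (s + 1)"
proof -
  define G where "G = {\<sigma>. \<sigma> permutes {1..n}}"
  define A where "A = {\<sigma>. \<sigma> permutes {1..n} \<and> restrict (\<lambda>i. y (\<sigma> i)) {1..k} \<in> B}"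
  define f where "f \<sigma> = v (\<lambda>i. y (\<sigma> i))" for \<sigma> :: "nat \<Rightarrow> nat"
  define h where "h \<sigma> = (\<Prod>i=k+1..n. l i (y (\<sigma> i)))" for \<sigma> :: "nat \<Rightarrow> nat"
  define T where "T = PiE {1..k} (\<lambda>_. X)"
  define R' where "R' = (\<Prod>i=k+1..n. weight_ratio X (l i))"
  have ne: "X \<noteq> {}" using X(2) n by (auto simp: Pi_iff)
  have I: "{1..k} \<subseteq> {1..n}" "{k+1..n} \<subseteq> {1..n}" using k by auto
  note b1 = weight_prod_bounds[OF X(1) ne l I(1), folded R_def]
  note b2 = weight_prod_bounds[OF X(1) ne l I(2), folded R'_def]
  have G: "finite G" "A \<subseteq> G" by (auto simp: G_def A_def finite_permutations)
  have idG: "id \<in> G" by (simp add: G_def permutes_id)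
  have yX: "y (\<sigma> i) \<in> X" if "\<sigma> \<in> G" "i \<in> {1..n}" for \<sigma> i
    using that X(2) permutes_in_image[of \<sigma> "{1..n}" i] by (auto simp: G_def)
  have fpos: "0 < f \<sigma>" if "\<sigma> \<in> G" for \<sigma>
    using b1(5)[of "\<lambda>i. y (\<sigma> i)"] b1(1) yX[OF that] k by (fastforce simp: f_def v_def)
  have sumf: "0 < sum f G" using fpos idG G by (intro sum_pos) auto
  have wfh: "w (\<lambda>i. y (\<sigma> i)) = f \<sigma> * h \<sigma>" for \<sigma>
    unfolding w_def f_def v_def h_def by (rule prod_split[OF k])
  have s2: "s\<^sup>2 = 1 / R'"
    using b2(2) unfolding s_def R'_def[symmetric]
    by (simp add: powr_minus powr_half_sqrt inverse_eq_divide power_divide)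
  have s1: "1 \<le> s"
    using b2(2,3) unfolding s_def R'_def[symmetric]
    by (simp add: powr_minus powr_half_sqrt inverse_eq_divide)
  have 1: "\<bar>(\<Sum>\<sigma>\<in>A. f \<sigma> * h \<sigma>) / (\<Sum>\<sigma>\<in>G. f \<sigma> * h \<sigma>) - sum f A / sum f G\<bar> \<le> (s - 1) / (s + 1)"
  proof (rule tilt_event_abs_le[OF G _ sumf _ _ b2(1) s1])
    fix \<sigma> assume \<sigma>: "\<sigma> \<in> G"
    then have "(\<lambda>i. y (\<sigma> i)) \<in> {k+1..n} \<rightarrow> X" using yX by auto
    from b2(5,6)[OF this] b2(4) show "(\<Prod>i\<in>{k + 1..n}. Min (l i ` X)) \<le> h \<sigma>"
      "h \<sigma> \<le> (\<Prod>i\<in>{k + 1..n}. Min (l i ` X)) * s\<^sup>2"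
      unfolding h_def s2 by simp_all
    show "0 \<le> f \<sigma>" using fpos[OF \<sigma>] by simp
  qed
  have avg: "sum f A / fact n = (\<Sum>z\<in>B. v z * urn_mass k z)" "sum f G / fact n = (\<Sum>z\<in>T. v z * urn_mass k z)"
  proof -
    have fT: "finite T" unfolding T_def using X by (intro finite_PiE) auto
    have vr: "f \<sigma> = v (restrict (\<lambda>i. y (\<sigma> i)) {1..k})" for \<sigma>
      unfolding f_def v_def by (intro prod.cong) auto
    have "sum f A / fact n = perm_avg n (\<lambda>\<sigma>. (\<lambda>z. v z * of_bool (z \<in> B)) (restrict (\<lambda>i. y (\<sigma> i)) {1..k}))"
      unfolding A_def vr by (rule perm_avg_of_bool[symmetric])
    also have "\<dots> = (\<Sum>z\<in>T. urn_mass k z * (v z * of_bool (z \<in> B)))"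
      unfolding T_def by (rule avg_prefix[OF X k])
    also have "\<dots> = (\<Sum>z\<in>T. if z \<in> B then v z * urn_mass k z else 0)" by (intro sum.cong) auto
    also have "\<dots> = (\<Sum>z\<in>B. v z * urn_mass k z)"
      using B fT by (subst sum.inter_restrict[symmetric]) (auto simp: T_def Int_absorb1)
    finally show "sum f A / fact n = (\<Sum>z\<in>B. v z * urn_mass k z)" .
    have "sum f G / fact n = perm_avg n (\<lambda>\<sigma>. v (restrict (\<lambda>i. y (\<sigma> i)) {1..k}))"
      unfolding G_def perm_avg_def vr by (rule refl)
    also have "\<dots> = (\<Sum>z\<in>T. urn_mass k z * v z)" unfolding T_def by (rule avg_prefix[OF X k])
    finally show "sum f G / fact n = (\<Sum>z\<in>T. v z * urn_mass k z)" by (simp add: mult.commute)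
  qed
  have "sum f A / sum f G = (sum f A / fact n) / (sum f G / fact n)" by simp
  then have q: "sum f A / sum f G = (\<Sum>z\<in>B. v z * urn_mass k z) / (\<Sum>z\<in>T. v z * urn_mass k z)"
    unfolding avg .
  have 2: "\<bar>(\<Sum>z\<in>B. v z * urn_mass k z) / (\<Sum>z\<in>T. v z * urn_mass k z)
      - (\<Sum>z\<in>B. v z * iid_mass k z) / (\<Sum>z\<in>T. v z * iid_mass k z)\<bar>
      \<le> (real (card X) * real k / real n) * (\<Prod>i\<in>{1..k}. Max (l i ` X)) / (\<Prod>i\<in>{1..k}. Min (l i ` X))"
  proof (rule weighted_event_abs_le)
    show "finite T" unfolding T_def using X by (intro finite_PiE) auto
    show "B \<subseteq> T" using B by (simp add: T_def)
    show "\<bar>sum (urn_mass k) C - sum (iid_mass k) C\<bar> \<le> real (card X) * real k / real n" if "C \<subseteq> T" for C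
      using sampling_without_replacement_vs_iid[OF X k] that by (simp add: T_def)
    show "sum (iid_mass k) T = 1" "sum (urn_mass k) T = 1"
      unfolding T_def by (rule sum_iid_mass[OF X] sum_urn_mass[OF X k])+
    show "(\<Prod>i\<in>{1..k}. Min (l i ` X)) \<le> v z" "v z \<le> (\<Prod>i\<in>{1..k}. Max (l i ` X))" if "z \<in> T" for z
      using b1(5,6)[of z] that unfolding v_def T_def by auto
    show "0 < (\<Prod>i\<in>{1..k}. Min (l i ` X))" by (rule b1(1))
  qed (auto simp: urn_mass_nonneg iid_mass_nonneg)
  have 3: "(real (card X) * real k / real n) * (\<Prod>i\<in>{1..k}. Max (l i ` X)) / (\<Prod>i\<in>{1..k}. Min (l i ` X))
      = real (card X) * real k / real n / R"
  proof -
    have "c * (m / R) / m = c / R" if "0 < m" for c m :: real using that by simp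
    from this[OF b1(1)] show ?thesis unfolding b1(4) .
  qed
  have "perm_avg n (\<lambda>\<sigma>. w (\<lambda>i. y (\<sigma> i)) * of_bool (restrict (\<lambda>i. y (\<sigma> i)) {1..k} \<in> B)) / perm_avg n (\<lambda>\<sigma>. w (\<lambda>i. y (\<sigma> i)))
     = (\<Sum>\<sigma>\<in>A. f \<sigma> * h \<sigma>) / (\<Sum>\<sigma>\<in>G. f \<sigma> * h \<sigma>)"
    unfolding perm_avg_of_bool wfh A_def[symmetric] by (simp add: perm_avg_def G_def)
  with 1 2 show ?thesis unfolding q 3 T_def[symmetric] by linarith
qed

end

section \<open>From permutations to measures on sequences\<close>
lemma seq_space_eq_count_space:
  assumes "finite X"
  shows "seq_space n X = count_space (PiE {1..n} (\<lambda>_. X))"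
  using assms by (intro count_space_PiM_finite) (auto intro: countable_finite)

lemma perm_comp_PiE:
  assumes "\<sigma> permutes {1..n}" "x \<in> PiE {1..n} (\<lambda>_. X)"
  shows "(\<lambda>i. x (\<sigma> i)) \<in> PiE {1..n} (\<lambda>_. X)"
proof (rule PiE_I)
  fix i assume "i \<in> {1..n}"
  then show "x (\<sigma> i) \<in> X" using assms permutes_in_image[OF assms(1), of i] by (auto simp: PiE_iff)
next
  fix i assume "i \<notin> {1..n}"
  then show "x (\<sigma> i) = undefined"
    using assms permutes_not_in[OF assms(1)] by (auto simp: PiE_iff extensional_def)
qed

text \<open>
  Dividing by the weight gives the masses of an exchangeable measure, whose point masses are invariant under permutations.
\<close>
lemma weighted_exchangeable_mass:
  fixes l :: "nat \<Rightarrow> 'a \<Rightarrow> real"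
  assumes X: "finite X" and l: "weight_seq n X l" and P: "weighted_exchangeable n X l P"
    and s: "\<sigma> permutes {1..n}" and y: "y \<in> PiE {1..n} (\<lambda>_. X)"
  defines "w \<equiv> \<lambda>x. \<Prod>i=1..n. l i (x i)"
  shows "measure P {\<lambda>i. y (\<sigma> i)} / w (\<lambda>i. y (\<sigma> i)) = measure P {y} / w y"
proof -
  let ?S = "PiE {1..n} (\<lambda>_. X)"
  let ?N = "seq_space n X"
  define D where "D = density P (\<lambda>x. ennreal (1 / w x))"
  define \<phi> where "\<phi> x = restrict (\<lambda>i. x (\<sigma> i)) {1..n}" for x :: "nat \<Rightarrow> 'a"
  have N: "?N = count_space ?S" by (rule seq_space_eq_count_space[OF X])
  have sP: "sets P = Pow ?S" using P N by (simp add: weighted_exchangeable_def)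
  then have spP: "space P = ?S" by (metis sets_eq_imp_space_eq sets_count_space space_count_space)
  have sD: "sets D = Pow ?S" "space D = ?S" by (simp_all add: D_def sP spP)
  have m: "g \<in> borel_measurable P" for g :: "(nat \<Rightarrow> 'a) \<Rightarrow> ennreal"
    using sP spP by (auto simp: measurable_def)
  have wpos: "0 < w x" if "x \<in> ?S" for x
    unfolding w_def using that l by (intro prod_pos) (auto simp: weight_seq_def PiE_iff)
  have mass: "measure D {x} = measure P {x} / w x" if x: "x \<in> ?S" for x
  proof -
    have "emeasure D {x} = (\<integral>\<^sup>+ z. ennreal (1 / w x) * indicator {x} z \<partial>P)"
      unfolding D_def using x sP
      by (subst emeasure_density) (auto intro!: nn_integral_cong m split: split_indicator)
    also have "\<dots> = ennreal (1 / w x) * emeasure P {x}" using x sP by (simp add: nn_integral_cmult_indicator)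
    finally show ?thesis using wpos[OF x] by (simp add: measure_def enn2real_mult)
  qed
  have inv: "distr D ?N \<phi> = D"
    using P s unfolding weighted_exchangeable_def exchangeable_def D_def w_def \<phi>_def by blast
  have ys: "(\<lambda>i. y (\<sigma> i)) \<in> ?S" by (rule perm_comp_PiE[OF s y])
  have "\<phi> x \<in> ?S" if "x \<in> ?S" for x
    using perm_comp_PiE[OF s that] unfolding \<phi>_def by auto
  then have meas: "\<phi> \<in> measurable D ?N"
    unfolding N using sD by (auto simp: measurable_def)
  have "\<phi> -` {\<lambda>i. y (\<sigma> i)} \<inter> space D = {y}"
  proof (intro equalityI subsetI)
    fix x assume "x \<in> \<phi> -` {\<lambda>i. y (\<sigma> i)} \<inter> space D"
    then have x: "x \<in> ?S" "\<phi> x = (\<lambda>i. y (\<sigma> i))" using sD by auto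
    have "x i = y i" if i: "i \<in> {1..n}" for i
    proof -
      have "inv \<sigma> i \<in> {1..n}" using permutes_in_image[OF permutes_inv[OF s]] i by simp
      then show ?thesis using fun_cong[OF x(2), of "inv \<sigma> i"] permutes_inverses(1)[OF s] by (simp add: \<phi>_def)
    qed
    then show "x \<in> {y}" using PiE_ext[OF x(1) y] by simp
  next
    fix x assume "x \<in> {y}"
    then show "x \<in> \<phi> -` {\<lambda>i. y (\<sigma> i)} \<inter> space D"
      using ys y sD unfolding \<phi>_def by (auto simp: restrict_PiE_iff intro!: extensional_restrict[of _ "{1..n}"] simp: PiE_iff)
  qed
  then have "measure (distr D ?N \<phi>) {\<lambda>i. y (\<sigma> i)} = measure D {y}"
    using meas ys N by (subst measure_distr) auto
  then show ?thesis unfolding inv using mass ys y by simp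
qed

text \<open>
  An exchangeable measure is the mixture, over its own samples \<open>y\<close>, of the laws of a uniformly random
  rearrangement of \<open>y\<close>. No grouping of the sequences by their type is needed.
\<close>
lemma sum_perm_avg:
  fixes \<phi> g :: "(nat \<Rightarrow> 'a) \<Rightarrow> real"
  assumes g: "\<And>y \<sigma>. y \<in> PiE {1..n} (\<lambda>_. X) \<Longrightarrow> \<sigma> permutes {1..n} \<Longrightarrow> g (\<lambda>i. y (\<sigma> i)) = g y"
  shows "(\<Sum>y\<in>PiE {1..n} (\<lambda>_. X). g y * perm_avg n (\<lambda>\<sigma>. \<phi> (\<lambda>i. y (\<sigma> i)))) = (\<Sum>x\<in>PiE {1..n} (\<lambda>_. X). g x * \<phi> x)"
proof -
  let ?S = "PiE {1..n} (\<lambda>_. X)"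
  have "(\<Sum>y\<in>?S. g y * perm_avg n (\<lambda>\<sigma>. \<phi> (\<lambda>i. y (\<sigma> i)))) = perm_avg n (\<lambda>\<sigma>. \<Sum>y\<in>?S. g y * \<phi> (\<lambda>i. y (\<sigma> i)))"
    by (simp only: perm_avg_sum perm_avg_cmult)
  also have "\<dots> = perm_avg n (\<lambda>_. \<Sum>x\<in>?S. g x * \<phi> x)"
  proof (rule perm_avg_cong)
    fix \<sigma> assume s: "\<sigma> permutes {1..n}"
    show "(\<Sum>y\<in>?S. g y * \<phi> (\<lambda>i. y (\<sigma> i))) = (\<Sum>x\<in>?S. g x * \<phi> x)"
      by (rule sum.reindex_bij_witness[where i = "\<lambda>x i. x (inv \<sigma> i)" and j = "\<lambda>y i. y (\<sigma> i)"])
        (use s g[OF _ s] perm_comp_PiE[OF s] perm_comp_PiE[OF permutes_inv[OF s]] in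
          \<open>simp_all add: permutes_inverses\<close>)
  qed
  finally show ?thesis by simp
qed

definition empirical :: "nat \<Rightarrow> 'a set \<Rightarrow> (nat \<Rightarrow> 'a) \<Rightarrow> 'a measure" where
  "empirical n X y = distr (uniform_count_measure {1..n}) (count_space X) y"

context urn
begin

lemma empirical_prob_algebra:
  assumes "y \<in> {1..n} \<rightarrow> X"
  shows "empirical n X y \<in> space (prob_algebra (count_space X))"
proof -
  interpret u: prob_space "uniform_count_measure {1..n}"
    using n by (intro prob_space_uniform_count_measure) auto
  have "y \<in> uniform_count_measure {1..n} \<rightarrow>\<^sub>M count_space X"
    using assms by (simp add: uniform_count_measure_def)
  then have "prob_space (empirical n X y)" unfolding empirical_def by (rule u.prob_space_distr)
  then show ?thesis by (simp add: space_prob_algebra empirical_def)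
qed

lemma measure_empirical:
  assumes "y \<in> {1..n} \<rightarrow> X" "a \<in> X"
  shows "measure (empirical n X y) {a} = freq a"
proof -
  have "y \<in> uniform_count_measure {1..n} \<rightarrow>\<^sub>M count_space X"
    using assms by (simp add: uniform_count_measure_def)
  then have "measure (empirical n X y) {a} = measure (uniform_count_measure {1..n}) (y -` {a} \<inter> {1..n})"
    unfolding empirical_def using assms by (subst measure_distr) (auto simp: space_uniform_count_measure)
  also have "\<dots> = real (card (y -` {a} \<inter> {1..n})) / real n"
    by (subst measure_uniform_count_measure) auto
  also have "y -` {a} \<inter> {1..n} = {1..n} \<inter> {i. y i = a}" by auto
  finally show ?thesis by (simp add: freq_def occ_def)
qed

lemma integral_empirical:
  fixes w :: "'a \<Rightarrow> real"
  assumes "finite X" "y \<in> {1..n} \<rightarrow> X"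
  shows "(\<integral>a. w a \<partial>empirical n X y) = (\<Sum>a\<in>X. w a * freq a)"
proof -
  have "y \<in> uniform_count_measure {1..n} \<rightarrow>\<^sub>M count_space X"
    using assms by (simp add: uniform_count_measure_def)
  then have "(\<integral>a. w a \<partial>empirical n X y) = (\<integral>i. w (y i) \<partial>uniform_count_measure {1..n})"
    unfolding empirical_def by (intro integral_distr) auto
  also have "\<dots> = (\<Sum>i=1..n. w (y i)) / real n" by (simp add: integral_uniform_count_measure)
  also have "(\<Sum>i=1..n. w (y i)) = (\<Sum>a\<in>X. occ n y a * w a)"
    using assms by (intro sum_occ[symmetric]) auto
  finally show ?thesis by (simp add: freq_def sum_divide_distrib mult.commute)
qed

text \<open>
  The tilted empirical measure gives mass \<open>l i a * freq a / L i\<close> to \<open>a\<close>, with \<open>L i\<close> the mean of \<open>l i\<close>,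
  so the first \<open>k\<close> coordinates have mass function \<open>v z * iid_mass k z\<close> up to the constant \<open>\<Prod>i=1..k. L i\<close>. Expanding
  that product into a sum over sequences identifies it with the normalizing constant.
\<close>
lemma measure_weighted_iid_empirical:
  fixes l :: "nat \<Rightarrow> 'a \<Rightarrow> real"
  assumes X: "finite X" "y \<in> {1..n} \<rightarrow> X" and k: "k \<le> n" and B: "B \<subseteq> PiE {1..k} (\<lambda>_. X)"
    and l: "weight_seq n X l"
  defines "v \<equiv> \<lambda>x. \<Prod>i=1..k. l i (x i)"
  shows "measure (weighted_iid n l (empirical n X y)) {x \<in> PiE {1..n} (\<lambda>_. X). restrict x {1..k} \<in> B}
      = (\<Sum>z\<in>B. v z * iid_mass k z) / (\<Sum>z\<in>PiE {1..k} (\<lambda>_. X). v z * iid_mass k z)"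
proof -
  let ?S = "PiE {1..n} (\<lambda>_. X)" and ?T = "PiE {1..k} (\<lambda>_. X)" and ?\<mu> = "empirical n X y"
  define L where "L i = (\<Sum>a\<in>X. l i a * freq a)" for i
  define t where "t i = (if i \<in> {1..n} then tilt (l i) ?\<mu> else ?\<mu>)" for i
  have \<mu>: "?\<mu> \<in> space (prob_algebra (count_space X))" by (rule empirical_prob_algebra[OF X(2)])
  have pos: "0 < l i x" if "i \<in> {1..n}" "x \<in> X" for i x using l that by (simp add: weight_seq_def)
  have tp: "t i \<in> space (prob_algebra (count_space X))" for i
    unfolding t_def using tilt_prob_algebra(1)[OF X(1) _ \<mu>, of "l i"] \<mu> pos by auto
  have tpr: "prob_space (t i)" "sets (t i) = Pow X" for i
    using tp[of i] by (auto simp: space_prob_algebra)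
  then have tsp: "space (t i) = X" for i
    by (metis sets_eq_imp_space_eq sets_count_space space_count_space)
  have tm: "measure (t i) {a} = l i a * freq a / L i" if i: "i \<in> {1..n}" and a: "a \<in> X" for i a
  proof -
    have "emeasure (tilt (l i) ?\<mu>) {a} = ennreal (l i a / L i) * emeasure ?\<mu> {a}"
      using tilt_prob_algebra(2)[OF X(1) pos[OF i] \<mu> a] unfolding integral_empirical[OF X] L_def .
    moreover have "0 \<le> L i" unfolding L_def using pos[OF i] freq_nonneg
      by (intro sum_nonneg mult_nonneg_nonneg) (auto intro: less_imp_le)
    ultimately show ?thesis
      using i pos[OF i a] measure_empirical[OF X(2) a] by (simp add: t_def measure_def enn2real_mult)
  qed
  interpret product_prob_space t "{1..n}"
    by (rule product_prob_spaceI) (rule tpr)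
  define W where "W = weighted_iid n l ?\<mu>"
  have W: "W = PiM {1..n} t" unfolding W_def weighted_iid_def by (rule PiM_cong) (auto simp: t_def)
  have sW: "sets W = Pow ?S"
    unfolding W using sets_PiM_cong[of "{1..n}" "{1..n}" t "\<lambda>_. count_space X"]
      seq_space_eq_count_space[OF X(1), of n] tpr(2) by simp
  interpret W: prob_space W unfolding W by (rule prob_space_PiM) (rule tpr(1))
  have single: "measure W {x \<in> ?S. restrict x {1..k} = z} = v z * iid_mass k z / (\<Prod>i=1..k. L i)" if z: "z \<in> ?T" for z
  proof -
    have "PiE {1..k} (\<lambda>i. {z i}) = {z}" using z by (intro PiE_singleton) (simp add: PiE_iff)
    then have "{x \<in> ?S. restrict x {1..k} = z} = prod_emb {1..n} t {1..k} (PiE {1..k} (\<lambda>i. {z i}))"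
      by (auto simp: prod_emb_def tsp)
    then have "measure W {x \<in> ?S. restrict x {1..k} = z} = (\<Prod>i=1..k. measure (t i) {z i})"
      unfolding W using z k tpr by (simp only:) (intro measure_PiM_emb, auto simp: PiE_iff)
    also have "\<dots> = (\<Prod>i=1..k. l i (z i) * freq (z i) / L i)"
      using z k by (intro prod.cong refl tm) auto
    finally show ?thesis by (simp add: v_def iid_mass_def prod.distrib prod_dividef)
  qed
  have "(\<Prod>i\<in>{1..k}. \<Sum>a\<in>X. l i a * freq a) = (\<Sum>z\<in>?T. \<Prod>i=1..k. l i (z i) * freq (z i))"
    using X by (intro prod_sum_PiE) auto
  then have LT: "(\<Prod>i=1..k. L i) = (\<Sum>z\<in>?T. v z * iid_mass k z)"
    by (simp add: L_def v_def iid_mass_def prod.distrib)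
  have fT: "finite ?T" using X by (intro finite_PiE) auto
  have "{x \<in> ?S. restrict x {1..k} \<in> B} = (\<Union>z\<in>B. {x \<in> ?S. restrict x {1..k} = z})" by auto
  then have "measure W {x \<in> ?S. restrict x {1..k} \<in> B} = (\<Sum>z\<in>B. measure W {x \<in> ?S. restrict x {1..k} = z})"
    using finite_subset[OF B fT] sW by (simp only:) (intro W.finite_measure_finite_Union, auto simp: disjoint_family_on_def)
  also have "\<dots> = (\<Sum>z\<in>B. v z * iid_mass k z / (\<Prod>i=1..k. L i))"
    using B by (intro sum.cong refl single) auto
  finally show ?thesis unfolding W_def LT by (simp add: sum_divide_distrib)
qed

end

section \<open>Mixtures of weighted i.i.d. distributions\<close>
definition prefix_event :: "nat \<Rightarrow> nat \<Rightarrow> 'a set \<Rightarrow> (nat \<Rightarrow> 'a) set \<Rightarrow> (nat \<Rightarrow> 'a) set" where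
  "prefix_event n k X B = {x \<in> PiE {1..n} (\<lambda>_. X). restrict x {1..k} \<in> B}"

lemma measure_first_marginal:
  assumes "finite X" "k \<le> n" "sets P = sets (seq_space n X)" "B \<subseteq> PiE {1..k} (\<lambda>_. X)"
  shows "measure (first_marginal k X P) B = measure P (prefix_event n k X B)"
proof -
  let ?S = "PiE {1..n} (\<lambda>_. X)"
  have sP: "sets P = Pow ?S" using assms(3) seq_space_eq_count_space[OF assms(1), of n] by simp
  then have spP: "space P = ?S" by (metis sets_eq_imp_space_eq sets_count_space space_count_space)
  have N: "seq_space k X = count_space (PiE {1..k} (\<lambda>_. X))" by (rule seq_space_eq_count_space[OF assms(1)])
  have m: "(\<lambda>x. restrict x {1..k}) \<in> measurable P (seq_space k X)"
    unfolding N using assms(2) sP spP by (auto simp: measurable_def PiE_iff)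
  have "measure (first_marginal k X P) B = measure P ((\<lambda>x. restrict x {1..k}) -` B \<inter> space P)"
    unfolding first_marginal_def by (rule measure_distr[OF m]) (use assms(4) N in simp)
  also have "(\<lambda>x. restrict x {1..k}) -` B \<inter> space P = prefix_event n k X B"
    unfolding prefix_event_def spP by auto
  finally show ?thesis .
qed

lemma finite_weighted_iid_mixture:
  fixes \<pi> :: "'b \<Rightarrow> real"
  assumes X: "finite X" and l: "weight_seq n X l" and S: "finite S"
    and \<pi>: "\<And>y. y \<in> S \<Longrightarrow> 0 \<le> \<pi> y" "sum \<pi> S = 1"
    and m: "\<And>y. y \<in> S \<Longrightarrow> m y \<in> space (prob_algebra (count_space X))"
  shows "\<exists>Q. weighted_iid_mixture n X l Q \<and> sets Q = sets (seq_space n X) \<and>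
    (\<forall>A. A \<subseteq> PiE {1..n} (\<lambda>_. X) \<longrightarrow> measure Q A = (\<Sum>y\<in>S. \<pi> y * measure (weighted_iid n l (m y)) A))"
proof -
  define p where "p = point_measure S (\<lambda>y. ennreal (\<pi> y))"
  define \<nu> where "\<nu> = distr p (prob_algebra (count_space X)) m"
  define Q where "Q = \<nu> \<bind> weighted_iid n l"
  have "emeasure p S = 1" unfolding p_def using S \<pi> by (simp add: emeasure_point_measure_finite sum_ennreal)
  then interpret p: prob_space p by (intro prob_spaceI) (simp add: p_def space_point_measure)
  have mm: "m \<in> p \<rightarrow>\<^sub>M prob_algebra (count_space X)" unfolding p_def using m by simp
  have \<nu>: "\<nu> \<in> space (prob_algebra (prob_algebra (count_space X)))"
    unfolding \<nu>_def by (simp add: space_prob_algebra p.prob_space_distr[OF mm])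
  have K: "weighted_iid n l \<in> prob_algebra (count_space X) \<rightarrow>\<^sub>M prob_algebra (seq_space n X)"
    by (rule measurable_weighted_iid[OF X l])
  have K\<nu>: "weighted_iid n l \<in> \<nu> \<rightarrow>\<^sub>M subprob_algebra (seq_space n X)"
    unfolding \<nu>_def using measurable_prob_algebraD[OF K] by simp
  have ne: "space \<nu> \<noteq> {}" unfolding \<nu>_def by (rule prob_space.not_empty[OF p.prob_space_distr[OF mm]])
  have N: "seq_space n X = count_space (PiE {1..n} (\<lambda>_. X))" by (rule seq_space_eq_count_space[OF X])
  have Km: "(\<lambda>\<mu>. emeasure (weighted_iid n l \<mu>) A) \<in> borel_measurable (prob_algebra (count_space X))"
    if "A \<in> sets (seq_space n X)" for A
    by (rule measurable_compose[OF measurable_prob_algebraD[OF K] measurable_emeasure_subprob_algebra[OF that]])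
  show ?thesis
  proof (intro exI[of _ Q] conjI allI impI)
    show "weighted_iid_mixture n X l Q" unfolding weighted_iid_mixture_def Q_def using \<nu> by blast
    show sQ: "sets Q = sets (seq_space n X)" unfolding Q_def by (rule sets_bind_measurable[OF K\<nu> ne])
    fix A assume A: "A \<subseteq> PiE {1..n} (\<lambda>_. X)"
    then have As: "A \<in> sets (seq_space n X)" unfolding N by simp
    have wp: "weighted_iid n l (m y) \<in> space (prob_algebra (seq_space n X))" if "y \<in> S" for y
      using measurable_space[OF K m[OF that]] .
    have em: "emeasure (weighted_iid n l (m y)) A = ennreal (measure (weighted_iid n l (m y)) A)" if "y \<in> S" for y
    proof -
      interpret w: prob_space "weighted_iid n l (m y)" using wp[OF that] by (simp add: space_prob_algebra)
      show ?thesis by (rule w.emeasure_eq_measure)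
    qed
    have "emeasure Q A = (\<integral>\<^sup>+\<mu>. emeasure (weighted_iid n l \<mu>) A \<partial>\<nu>)"
      unfolding Q_def by (rule emeasure_bind[OF ne K\<nu> As])
    also have "\<dots> = (\<integral>\<^sup>+y. emeasure (weighted_iid n l (m y)) A \<partial>p)"
      unfolding \<nu>_def
      by (rule nn_integral_distr[OF mm]) (use Km[OF As] in simp)
    also have "\<dots> = (\<Sum>y\<in>S. ennreal (\<pi> y) * emeasure (weighted_iid n l (m y)) A)"
      unfolding p_def by (rule nn_integral_point_measure_finite[OF S])
    also have "\<dots> = (\<Sum>y\<in>S. ennreal (\<pi> y * measure (weighted_iid n l (m y)) A))"
      by (intro sum.cong refl) (simp add: em ennreal_mult \<pi>(1))
    also have "\<dots> = ennreal (\<Sum>y\<in>S. \<pi> y * measure (weighted_iid n l (m y)) A)"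
      by (intro sum_ennreal) (simp add: \<pi>(1))
    finally show "measure Q A = (\<Sum>y\<in>S. \<pi> y * measure (weighted_iid n l (m y)) A)"
      unfolding measure_def[of Q] by (simp add: sum_nonneg \<pi>(1))
  qed
qed

theorem theorem3p2:
  fixes X :: "'a set" and n k :: nat and l :: "nat \<Rightarrow> 'a \<Rightarrow> real"
    and P :: "(nat \<Rightarrow> 'a) measure" and r :: "nat \<Rightarrow> real"
  assumes "finite X"
    and "1 \<le> n"
    and "weight_seq n X l"
    and "weighted_exchangeable n X l P"
    and "1 \<le> k" and "k \<le> n"
    and "\<And>i. i \<in> {1..n} \<Longrightarrow> r i = weight_ratio X (l i)"
    and "\<And>i. i \<in> {1..n} \<Longrightarrow> r i > 0"
  shows "\<exists>Q. weighted_iid_mixture n X l Q \<and>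
           tv_dist (first_marginal k X P) (first_marginal k X Q)
             \<le> real (card X) * real k / real n
                   * ((3 - (\<Prod>i=1..k. r i)) / (2 * (\<Prod>i=1..k. r i)))
               + ((\<Prod>i=k+1..n. r i) powr (- 1/2) - 1)
                   / ((\<Prod>i=k+1..n. r i) powr (- 1/2) + 1)"
proof -
  let ?S = "PiE {1..n} (\<lambda>_. X)" and ?T = "PiE {1..k} (\<lambda>_. X)"
  note X = assms(1) and n = assms(2) and l = assms(3) and wP = assms(4) and k = assms(6)
  define w where "w x = (\<Prod>i=1..n. l i (x i))" for x
  define v where "v x = (\<Prod>i=1..k. l i (x i))" for x
  define g where "g y = measure P {y} / w y" for y
  define Z where "Z y = perm_avg n (\<lambda>\<sigma>. w (\<lambda>i. y (\<sigma> i)))" for y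
  \<comment> \<open>the mass \<open>g y\<close> of the urn \<open>y\<close>, corrected by the normalizing constant of its weighted law\<close>
  define \<pi> where "\<pi> y = g y * Z y" for y
  define R where "R = (\<Prod>i=1..k. weight_ratio X (l i))"
  define s where "s = (\<Prod>i=k+1..n. weight_ratio X (l i)) powr (- 1/2)"
  define \<epsilon> where "\<epsilon> = real (card X) * real k / real n / R + (s - 1) / (s + 1)"
  have N: "seq_space n X = count_space ?S" by (rule seq_space_eq_count_space[OF X])
  have sP': "sets P = sets (seq_space n X)" using wP by (simp add: weighted_exchangeable_def)
  then have sP: "sets P = Pow ?S" using N by simp
  then have spP: "space P = ?S" by (metis sets_eq_imp_space_eq sets_count_space space_count_space)
  interpret P: prob_space P using wP by (simp add: weighted_exchangeable_def)
  have fS: "finite ?S" using X by (intro finite_PiE) auto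
  have ne: "X \<noteq> {}" using P.not_empty n unfolding spP by (auto simp: PiE_eq_empty_iff)
  have u: "urn n" using n by unfold_locales
  have wpos: "0 < w x" if "x \<in> ?S" for x
    unfolding w_def using that l by (intro prod_pos) (auto simp: weight_seq_def PiE_iff)
  have g0: "0 \<le> g y" if "y \<in> ?S" for y using wpos[OF that] by (simp add: g_def)
  have Zpos: "0 < Z y" if "y \<in> ?S" for y unfolding Z_def
    by (rule perm_avg_pos[where ?\<sigma>0.0 = id]) (auto intro!: less_imp_le wpos perm_comp_PiE that permutes_id)
  have ginv: "g (\<lambda>i. y (\<sigma> i)) = g y" if "y \<in> ?S" "\<sigma> permutes {1..n}" for y \<sigma>
    unfolding g_def w_def by (rule weighted_exchangeable_mass[OF X l wP that(2,1)])
  have mP: "measure P A = (\<Sum>x\<in>?S. g x * (w x * of_bool (x \<in> A)))" if A: "A \<subseteq> ?S" for A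
  proof -
    have "measure P A = (\<Sum>x\<in>A. measure P {x})"
      using finite_subset[OF A fS] A sP by (intro P.finite_measure_eq_sum_singleton) auto
    also have "\<dots> = (\<Sum>x\<in>?S. if x \<in> A then measure P {x} else 0)"
      using A fS by (subst sum.inter_restrict[symmetric]) (auto simp: Int_absorb1)
    also have "\<dots> = (\<Sum>x\<in>?S. g x * (w x * of_bool (x \<in> A)))"
    proof (rule sum.cong[OF refl])
      fix x assume "x \<in> ?S"
      from wpos[OF this] show "(if x \<in> A then measure P {x} else 0) = g x * (w x * of_bool (x \<in> A))"
        by (simp add: g_def)
    qed
    finally show ?thesis .
  qed
  \<comment> \<open>symmetrizing: \<open>P\<close> is a mixture of weighted urns\<close>
  have mPB: "measure P (prefix_event n k X B)
      = (\<Sum>y\<in>?S. g y * perm_avg n (\<lambda>\<sigma>. w (\<lambda>i. y (\<sigma> i)) * of_bool (restrict (\<lambda>i. y (\<sigma> i)) {1..k} \<in> B)))" for B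
  proof -
    have "prefix_event n k X B \<subseteq> ?S" by (auto simp: prefix_event_def)
    then have "measure P (prefix_event n k X B) = (\<Sum>x\<in>?S. g x * (w x * of_bool (x \<in> prefix_event n k X B)))"
      by (rule mP)
    also have "\<dots> = (\<Sum>x\<in>?S. g x * (w x * of_bool (restrict x {1..k} \<in> B)))"
      by (intro sum.cong refl) (simp add: prefix_event_def)
    also have "\<dots> = (\<Sum>y\<in>?S. g y * perm_avg n (\<lambda>\<sigma>. w (\<lambda>i. y (\<sigma> i)) * of_bool (restrict (\<lambda>i. y (\<sigma> i)) {1..k} \<in> B)))"
      by (rule sum_perm_avg[OF ginv, where \<phi> = "\<lambda>x. w x * of_bool (restrict x {1..k} \<in> B)", symmetric])
    finally show ?thesis .
  qed
  have \<pi>0: "0 \<le> \<pi> y" if "y \<in> ?S" for y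
    using g0[OF that] Zpos[OF that] by (simp add: \<pi>_def)
  have \<pi>1: "sum \<pi> ?S = 1"
  proof -
    have "sum \<pi> ?S = (\<Sum>x\<in>?S. g x * w x)"
      unfolding \<pi>_def Z_def by (rule sum_perm_avg[OF ginv])
    also have "\<dots> = measure P ?S" by (subst mP) auto
    finally show ?thesis using P.prob_space by (simp add: spP)
  qed
  have emp: "empirical n X y \<in> space (prob_algebra (count_space X))" if "y \<in> ?S" for y
    using that by (intro urn.empirical_prob_algebra[OF u]) auto
  obtain Q where Q: "weighted_iid_mixture n X l Q" "sets Q = sets (seq_space n X)"
    "\<And>A. A \<subseteq> ?S \<Longrightarrow> measure Q A = (\<Sum>y\<in>?S. \<pi> y * measure (weighted_iid n l (empirical n X y)) A)"
    using finite_weighted_iid_mixture[where m = "empirical n X" and \<pi> = \<pi>, OF X l fS \<pi>0 \<pi>1 emp]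
    by blast
  have event: "\<bar>measure (first_marginal k X P) B - measure (first_marginal k X Q) B\<bar> \<le> \<epsilon>" if B: "B \<subseteq> ?T" for B
  proof -
    define a where "a y = perm_avg n (\<lambda>\<sigma>. w (\<lambda>i. y (\<sigma> i)) * of_bool (restrict (\<lambda>i. y (\<sigma> i)) {1..k} \<in> B)) / Z y" for y
    define b where "b y = measure (weighted_iid n l (empirical n X y)) (prefix_event n k X B)" for y
    have ab: "\<bar>a y - b y\<bar> \<le> \<epsilon>" if y: "y \<in> ?S" for y
    proof -
      have yX: "y \<in> {1..n} \<rightarrow> X" using y by auto
      show ?thesis
        using urn.weighted_urn_vs_weighted_iid[OF u X yX k B l]
        unfolding urn.measure_weighted_iid_empirical[OF u X yX k B l, folded prefix_event_def, folded b_def, symmetric]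
        unfolding a_def Z_def w_def \<epsilon>_def R_def s_def .
    qed
    have "measure P (prefix_event n k X B) = (\<Sum>y\<in>?S. \<pi> y * a y)"
      unfolding mPB
    proof (rule sum.cong[OF refl])
      fix y assume "y \<in> ?S"
      from Zpos[OF this]
      show "g y * perm_avg n (\<lambda>\<sigma>. w (\<lambda>i. y (\<sigma> i)) * of_bool (restrict (\<lambda>i. y (\<sigma> i)) {1..k} \<in> B)) = \<pi> y * a y"
        by (simp add: \<pi>_def a_def)
    qed
    moreover have "measure Q (prefix_event n k X B) = (\<Sum>y\<in>?S. \<pi> y * b y)"
      unfolding b_def by (rule Q(3)) (auto simp: prefix_event_def)
    ultimately have "\<bar>measure (first_marginal k X P) B - measure (first_marginal k X Q) B\<bar>
        = \<bar>\<Sum>y\<in>?S. \<pi> y * (a y - b y)\<bar>"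
      unfolding measure_first_marginal[OF X k sP' B] measure_first_marginal[OF X k Q(2) B]
      by (simp add: right_diff_distrib sum_subtractf)
    also have "\<dots> \<le> (\<Sum>y\<in>?S. \<bar>\<pi> y * (a y - b y)\<bar>)" by (rule sum_abs)
    also have "\<dots> \<le> (\<Sum>y\<in>?S. \<pi> y * \<epsilon>)"
      using \<pi>0 ab by (intro sum_mono) (simp add: abs_mult mult_left_mono)
    also have "\<dots> = \<epsilon>" unfolding sum_distrib_right[symmetric] \<pi>1 by simp
    finally show ?thesis .
  qed
  have "sets (first_marginal k X P) = Pow ?T"
    unfolding first_marginal_def using seq_space_eq_count_space[OF X, of k] by simp
  then have tv: "tv_dist (first_marginal k X P) (first_marginal k X Q) \<le> \<epsilon>"
    unfolding tv_dist_def using event by (intro cSUP_least) auto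
  have r: "(\<Prod>i=1..k. r i) = R" "(\<Prod>i=k+1..n. r i) powr (- 1/2) = s"
    unfolding R_def s_def using assms(7) k by (auto intro!: prod.cong arg_cong[where f="\<lambda>x. x powr _"])
  have "\<epsilon> \<le> real (card X) * real k / real n * ((3 - R) / (2 * R)) + (s - 1) / (s + 1)"
  proof -
    have I: "{1..k} \<subseteq> {1..n}" using k by auto
    have R: "0 < R" "R \<le> 1" unfolding R_def by (rule weight_prod_bounds(2,3)[OF X ne l I])+
    \<comment> \<open>since \<open>R \<le> 1\<close>, the factor \<open>(3 - R) / 2\<close> is at least \<open>1\<close>\<close>
    then have "1 / R \<le> (3 - R) / (2 * R)" by (simp add: field_simps)
    then have "real (card X) * real k / real n * (1 / R) \<le> real (card X) * real k / real n * ((3 - R) / (2 * R))"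
      by (rule mult_left_mono) simp
    then show ?thesis by (simp add: \<epsilon>_def)
  qed
  with tv show ?thesis unfolding r using Q(1) by (blast intro: order_trans)
qed

end
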